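(* Let $p$ be a prime, $n,m\ge1$, $q_1,\dots,q_m\in[1,\infty)$ and $\frac1q=\frac1{q_1}+\cdots+\frac1{q_m}$. Let $1\le q^*,\zeta<\infty$, $\Omega\in L^{(q/\zeta)'}(S_0)$, $\lambda_i\in\left(-\frac1{q_i},0\right)$ for $i=1,\dots,m$, and let $\omega\in A_\zeta(\mathbb Q_p^n)$ have finite critical index $r_\omega$ for the reverse Hölder condition. Assume $q>q^*\zeta r_\omega/(r_\omega-1)$, $\delta\in(1,r_\omega)$, $\lambda^*=\lambda_1+\cdots+\lambda_m$, and $$\mathcal C_2=\sum_{\gamma\ge0}\frac{\Phi(p^\gamma)}{p^{\gamma(1+n\zeta\lambda^* )}}+\sum_{\gamma<0}\frac{\Phi(p^\gamma)}{p^{\gamma(1+n\lambda^*(\delta-1)/\delta)}}<\infty.$$ Then $\mathcal H^p_{\Phi,\Omega}$ is bounded from $\dot B^{q_1,\lambda_1}_{\omega}(\mathbb Q_p^n)\times\cdots\times\dot B^{q_m,\lambda_m}_{\omega}(\mathbb Q_p^n)$ to $\dot B^{q^*,\lambda^*}_{\omega}(\mathbb Q_p^n)$.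
   Context: $\mathbb Q_p$ is the field of $p$-adic numbers with norm $|\cdot|_p$; on $\mathbb Q_p^n$, $|x|_p=\max_j|x_j|_p$. $B_\gamma=\{|x|_p\le p^\gamma\}$, $S_\gamma=\{|x|_p=p^\gamma\}$, balls are sets $\{x:|x-a|_p\le p^\gamma\}$, and $dx$ is Haar measure with $|B_0|=1$. $\Phi:\mathbb Q_p\to[0,\infty)$ is measurable, $\Omega:S_0\to\mathbb C$ is measurable and nonzero a.e.; $s'$ denotes the conjugate exponent of $s$. The operator is $$\mathcal H^p_{\Phi,\Omega}(\vec f)(x)=\sum_{\gamma\in\mathbb Z}\int_{S_0}\frac{\Phi(p^\gamma)}{p^\gamma}\Omega(y)\prod_{i=1}^m f_i(p^\gamma|x|_p^{-1}y)\,dy.$$ For a weight $w$, $w(E)=\int_Ew$. The space $\dot B^{s,\mu}_{w}(\mathbb Q_p^n)$ consists of $f\in L^s_{w,\mathrm{loc}}$ with $\|f\|_{\dot B^{s,\mu}_w}=\sup_{\gamma\in\mathbb Z}\big(w(B_\gamma)^{-1-\mu s}\int_{B_\gamma}|f|^sw\big)^{1/s}<\infty$. For $1<\zeta<\infty$, $\omega\in A_\zeta(\mathbb Q_p^n)$ if $\big(\frac1{|B|}\int_B\omega\big)\big(\frac1{|B|}\int_B\omega^{-1/(\zeta-1)}\big)^{\zeta-1}\le C$ for all balls $B$; $\omega\in A_1$ if $\frac1{|B|}\int_B\omega\le C\,\mathrm{ess\,inf}_B\omega$ for all balls $B$. $\omega\in RH_r$ ($r>1$) if $\big(\frac1{|B|}\int_B\omega^r\big)^{1/r}\le\frac{C}{|B|}\int_B\omega$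 for all balls $B$, and the critical index is $r_\omega=\sup\{r>1:\omega\in RH_r\}$. Bounded means $\|\mathcal H^p_{\Phi,\Omega}(\vec f)\|_Y\le C\prod_i\|f_i\|_{X_i}$. *)

theory Defs
  imports "HOL-Analysis.Analysis"
begin

text \<open>Model of the p-adic numbers by canonical digit expansions
  x = sum_k d k * p^k  (digits d k in {0..p-1}, d k = 0 for k sufficiently negative).
  Points of Q_p^n are maps from a finite index type 'n (so n = CARD('n)) to digit sequences.\<close>

definition padic_digits :: "nat \<Rightarrow> (int \<Rightarrow> nat) set" where
  "padic_digits p = {d. (\<forall>k. d k < p) \<and> (\<exists>N. \<forall>k<N. d k = 0)}"

definition Qpn :: "nat \<Rightarrow> ('n::finite \<Rightarrow> int \<Rightarrow> nat) set" where
  "Qpn p = {x. \<forall>i. x i \<in> padic_digits p}"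

definition pord :: "(int \<Rightarrow> nat) \<Rightarrow> int" where
  "pord d = (THE k. d k \<noteq> 0 \<and> (\<forall>j<k. d j = 0))"

definition padic_abs :: "nat \<Rightarrow> (int \<Rightarrow> nat) \<Rightarrow> real" where
  "padic_abs p d = (if (\<forall>k. d k = 0) then 0 else real p powr (- real_of_int (pord d)))"

definition vnorm :: "nat \<Rightarrow> ('n::finite \<Rightarrow> int \<Rightarrow> nat) \<Rightarrow> real" where
  "vnorm p x = Max (range (\<lambda>i. padic_abs p (x i)))"

text \<open>exponent v with |x|_p = p^v (for x nonzero)\<close>
definition vexp :: "nat \<Rightarrow> ('n::finite \<Rightarrow> int \<Rightarrow> nat) \<Rightarrow> int" where
  "vexp p x = \<lfloor>log (real p) (vnorm p x)\<rfloor>"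

definition ppow :: "int \<Rightarrow> (int \<Rightarrow> nat)" where
  "ppow g = (\<lambda>k. if k = g then 1 else 0)"

text \<open>dilation y \<mapsto> p^j y (shift of digits)\<close>
definition pdil :: "int \<Rightarrow> ('n \<Rightarrow> int \<Rightarrow> nat) \<Rightarrow> ('n \<Rightarrow> int \<Rightarrow> nat)" where
  "pdil j y = (\<lambda>i k. y i (k - j))"

definition Bg :: "nat \<Rightarrow> int \<Rightarrow> ('n::finite \<Rightarrow> int \<Rightarrow> nat) set" where
  "Bg p g = {x \<in> Qpn p. vnorm p x \<le> real p powr real_of_int g}"

definition Sg :: "nat \<Rightarrow> int \<Rightarrow> ('n::finite \<Rightarrow> int \<Rightarrow> nat) set" where
  "Sg p g = {x \<in> Qpn p. vnorm p x = real p powr real_of_int g}"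

text \<open>The ball {x : |x - a|_p \<le> p^g}: for canonical digit expansions |x-a|_p \<le> p^g iff
  the digits of x and a agree at all positions k < -g (componentwise).\<close>
definition pball :: "nat \<Rightarrow> int \<Rightarrow> ('n::finite \<Rightarrow> int \<Rightarrow> nat) \<Rightarrow> ('n \<Rightarrow> int \<Rightarrow> nat) set" where
  "pball p g a = {x \<in> Qpn p. \<forall>i k. k < - g \<longrightarrow> x i k = a i k}"

definition pballs :: "nat \<Rightarrow> ('n::finite \<Rightarrow> int \<Rightarrow> nat) set set" where
  "pballs p = {pball p g a | g a. a \<in> Qpn p}"

text \<open>Haar measure on Q_p^n with |B_0| = 1, obtained as the image of Lebesgue measure on
  [0,\<infinity>)^n under the (inverse) Monna map t \<mapsto> digits of t in base p
  (t = sum_k d k p^(-k-1)). The sigma-algebra is the Borel one (generated by the balls).\<close>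
definition monna :: "nat \<Rightarrow> real ^ 'n \<Rightarrow> ('n::finite \<Rightarrow> int \<Rightarrow> nat)" where
  "monna p t = (\<lambda>i k. nat \<lfloor>t $ i * real p powr real_of_int (k + 1)\<rfloor> mod p)"

definition haar :: "nat \<Rightarrow> ('n::finite \<Rightarrow> int \<Rightarrow> nat) measure" where
  "haar p = distr (restrict_space lborel {t :: real ^ 'n. \<forall>i. 0 \<le> t $ i})
                  (sigma (Qpn p) (pballs p)) (monna p)"

definition wmeas :: "nat \<Rightarrow> (('n::finite \<Rightarrow> int \<Rightarrow> nat) \<Rightarrow> real) \<Rightarrow> ('n \<Rightarrow> int \<Rightarrow> nat) set \<Rightarrow> real" where
  "wmeas p w E = (LINT x:E|haar p. w x)"

definition is_weight :: "nat \<Rightarrow> (('n::finite \<Rightarrow> int \<Rightarrow> nat) \<Rightarrow> real) \<Rightarrow> bool" where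
  "is_weight p w \<longleftrightarrow> w \<in> borel_measurable (haar p) \<and> (AE x in haar p. 0 < w x)
     \<and> (\<forall>B\<in>pballs p. set_integrable (haar p) B w)"

definition avg :: "nat \<Rightarrow> ('n::finite \<Rightarrow> int \<Rightarrow> nat) set \<Rightarrow> (('n \<Rightarrow> int \<Rightarrow> nat) \<Rightarrow> real) \<Rightarrow> real" where
  "avg p B f = (LINT x:B|haar p. f x) / measure (haar p) B"

definition A_weight :: "nat \<Rightarrow> real \<Rightarrow> (('n::finite \<Rightarrow> int \<Rightarrow> nat) \<Rightarrow> real) \<Rightarrow> bool" where
  "A_weight p \<zeta> w \<longleftrightarrow> is_weight p w \<and>
     (if \<zeta> = 1 then
        (\<exists>C. \<forall>B\<in>pballs p. AE x in haar p. x \<in> B \<longrightarrow> avg p B w \<le> C * w x)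
      else
        (\<forall>B\<in>pballs p. set_integrable (haar p) B (\<lambda>x. w x powr (-1 / (\<zeta> - 1)))) \<and>
        (\<exists>C. \<forall>B\<in>pballs p.
            avg p B w * (avg p B (\<lambda>x. w x powr (-1 / (\<zeta> - 1)))) powr (\<zeta> - 1) \<le> C))"

definition RH :: "nat \<Rightarrow> real \<Rightarrow> (('n::finite \<Rightarrow> int \<Rightarrow> nat) \<Rightarrow> real) \<Rightarrow> bool" where
  "RH p r w \<longleftrightarrow> (\<forall>B\<in>pballs p. set_integrable (haar p) B (\<lambda>x. w x powr r)) \<and>
     (\<exists>C. \<forall>B\<in>pballs p. (avg p B (\<lambda>x. w x powr r)) powr (1 / r) \<le> C * avg p B w)"

definition RH_set :: "nat \<Rightarrow> (('n::finite \<Rightarrow> int \<Rightarrow> nat) \<Rightarrow> real) \<Rightarrow> real set" where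
  "RH_set p w = {r. 1 < r \<and> RH p r w}"

definition crit_index :: "nat \<Rightarrow> (('n::finite \<Rightarrow> int \<Rightarrow> nat) \<Rightarrow> real) \<Rightarrow> real" where
  "crit_index p w = Sup (RH_set p w)"

definition Bterm :: "nat \<Rightarrow> real \<Rightarrow> real \<Rightarrow> (('n::finite \<Rightarrow> int \<Rightarrow> nat) \<Rightarrow> real)
    \<Rightarrow> (('n \<Rightarrow> int \<Rightarrow> nat) \<Rightarrow> complex) \<Rightarrow> int \<Rightarrow> real" where
  "Bterm p s \<mu> w f g = (wmeas p w (Bg p g) powr (-1 - \<mu> * s)
       * (LINT x:Bg p g|haar p. norm (f x) powr s * w x)) powr (1 / s)"

definition Bmem :: "nat \<Rightarrow> real \<Rightarrow> real \<Rightarrow> (('n::finite \<Rightarrow> int \<Rightarrow> nat) \<Rightarrow> real)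
    \<Rightarrow> (('n \<Rightarrow> int \<Rightarrow> nat) \<Rightarrow> complex) \<Rightarrow> bool" where
  "Bmem p s \<mu> w f \<longleftrightarrow> f \<in> borel_measurable (haar p)
     \<and> (\<forall>B\<in>pballs p. set_integrable (haar p) B (\<lambda>x. norm (f x) powr s * w x))
     \<and> bdd_above (range (Bterm p s \<mu> w f))"

definition Bnorm :: "nat \<Rightarrow> real \<Rightarrow> real \<Rightarrow> (('n::finite \<Rightarrow> int \<Rightarrow> nat) \<Rightarrow> real)
    \<Rightarrow> (('n \<Rightarrow> int \<Rightarrow> nat) \<Rightarrow> complex) \<Rightarrow> real" where
  "Bnorm p s \<mu> w f = (SUP g. Bterm p s \<mu> w f g)"

text \<open>The multilinear p-adic Hausdorff operator (set to 0 at x = 0, a null set)\<close>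
definition Hop :: "nat \<Rightarrow> ((int \<Rightarrow> nat) \<Rightarrow> real) \<Rightarrow> (('n::finite \<Rightarrow> int \<Rightarrow> nat) \<Rightarrow> complex)
    \<Rightarrow> nat \<Rightarrow> (nat \<Rightarrow> ('n \<Rightarrow> int \<Rightarrow> nat) \<Rightarrow> complex) \<Rightarrow> ('n \<Rightarrow> int \<Rightarrow> nat) \<Rightarrow> complex" where
  "Hop p \<Phi> \<Omega> m fs x = (if vnorm p x = 0 then 0 else
     (\<Sum>\<^sub>\<infinity>g\<in>(UNIV::int set). LINT y:Sg p 0|haar p.
         complex_of_real (\<Phi> (ppow g) / real p powr real_of_int g) * \<Omega> y
         * (\<Prod>i<m. fs i (pdil (g - vexp p x) y))))"

end

theory Submission
  imports Defs
begin

text \<open>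
  The function \<open>H f\<close> is radial, so everything reduces to a pointwise bound on the sphere
  \<open>|x| = p\<^sup>v\<close>. The Hoelder inequality on \<open>S\<^sub>0\<close>, with exponent \<open>(q/\<zeta>)'\<close> for \<open>\<Omega>\<close> and \<open>q\<^sub>i/\<zeta>\<close> for \<open>f\<^sub>i\<close>,
  followed by the \<open>A\<^sub>\<zeta>\<close> condition in the form \<open>(avg\<^sub>B u)\<^sup>\<zeta> \<le> K / w(B) \<integral>\<^sub>B u\<^sup>\<zeta> w\<close>, bounds the term of
  index \<open>g\<close> by \<open>\<Phi>(p\<^sup>g) / p\<^sup>g\<close> times the power \<open>\<lambda>\<close> of \<open>w(B(v - g))\<close>. Comparing \<open>w(B(v - g))\<close> with
  \<open>w(B(v))\<close> by \<open>A\<^sub>\<zeta>\<close> (\<open>g \<ge> 0\<close>) or by a reverse Hoelder inequality (\<open>g < 0\<close>) and summing over \<open>g\<close> gives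
  \<open>|H f x| \<le> C w(B(v))\<^sup>\<lambda>\<close>. The norm of such a function is finite because, for
  \<open>e = 1 + \<lambda> q\<^sup>*\<close> in \<open>(0, 1)\<close>, the estimate \<open>b\<^sup>e (b - a) / b \<le> (b\<^sup>e - a\<^sup>e) / e\<close> makes the sum over spheres
  telescope.

  Since \<open>Sup {}\<close> is an unspecified real, \<open>\<delta> < r\<^sub>w\<close> yields a reverse Hoelder exponent only if one
  exists at all; that every \<open>A\<^sub>\<zeta>\<close> weight has one is shown by a Calderon-Zygmund stopping argument.
\<close>

subsection \<open>Balls and Haar measure\<close>

text \<open>Since \<lambda> < 0, an upper bound for the power \<lambda> of
  \<open>w(B(v - g))\<close> is a lower bound for the mass itself. This decides which property of
  the weight serves which half of the sum. For \<open>g \<ge> 0\<close> the ball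
  \<open>B(v - g)\<close> lies inside \<open>B(v)\<close>, and \<open>A\<^sub>\<zeta>\<close> says
  that its mass shrinks at most like \<open>p\<close> to the power \<open>- n \<zeta> g\<close>; for
  \<open>g < 0\<close> it contains \<open>B(v)\<close>, and the reverse Hoelder inequality says that
  its mass grows at least like \<open>p\<close> to the power
  \<open>- n g (\<delta> - 1) / \<delta>\<close>. Hence the two exponents in the sums over
  \<open>\<Phi>\<close>. The Hoelder exponents fit because \<open>1 - \<zeta> / q\<close> and the
  numbers \<open>\<zeta> / q_i\<close> add up to one. The size of \<open>q\<close> enters through
  \<open>\<zeta> < q\<close>, which makes the exponent of \<open>\<Omega>\<close> a genuine one, and
  \<open>qstar < q\<close>, which together with \<open>\<lambda> > - 1 / q\<close> puts
  \<open>e\<close> into \<open>(0, 1)\<close>.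

  Haar measure comes from Lebesgue measure through digit expansions, so its scaling has to be read
  off from its values on balls. The ultrametric helps: balls that meet are nested, so maximal balls
  are disjoint.\<close>

lemma digits_eqI:
  fixes p a b :: nat
  assumes p: "2 \<le> p" and eq: "\<And>j. a div p ^ j mod p = b div p ^ j mod p"
  shows "a = b"
  using eq
proof (induction "a + b" arbitrary: a b rule: less_induct)
  case less
  show ?case
  proof (cases "a + b = 0")
    case False
    have lt: "a div p + b div p < a + b"
    proof (cases "a = 0")
      case True
      then show ?thesis using False p by (simp add: div_less_dividend)
    next
      case False
      then have "a div p < a" using p by simp
      moreover have "b div p \<le> b" by simp
      ultimately show ?thesis by linarith
    qed
    have "a div p = b div p"
    proof (rule less.hyps[OF lt])
      fix j
      show "a div p div p ^ j mod p = b div p div p ^ j mod p"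
        using less.prems[of "Suc j"] by (simp add: div_mult2_eq)
    qed
    moreover have "a mod p = b mod p" using less.prems[of 0] by simp
    ultimately show ?thesis by (metis div_mult_mod_eq)
  qed simp
qed

lemma digits_exist:
  fixes p :: nat
  assumes "2 \<le> p" "\<And>j. e j < p" "\<And>j. J \<le> j \<Longrightarrow> e j = 0"
  shows "\<exists>n. \<forall>j. n div p ^ j mod p = e j"
  using assms
proof (induction J arbitrary: e)
  case 0
  then show ?case by (intro exI[of _ 0]) auto
next
  case (Suc J)
  obtain n where n: "n div p ^ j mod p = e (Suc j)" for j
    using Suc.IH[of "\<lambda>j. e (Suc j)"] Suc.prems by auto
  have "(e 0 + p * n) div p ^ j mod p = e j" for j
  proof (cases j)
    case 0
    then show ?thesis using Suc.prems(2) by simp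
  next
    case (Suc i)
    have "(e 0 + p * n) div p = n" using Suc.prems(1,2) Suc.prems(2)[of 0] by simp
    then show ?thesis using n[of i] Suc by (simp add: div_mult2_eq)
  qed
  then show ?case by blast
qed

locale padic =
  fixes p :: nat
  assumes p_ge2: "2 \<le> p"
begin

lemma p_pos [simp]: "0 < real p" "1 < real p" "1 \<le> real p" "0 < p" "p \<noteq> 0" "Suc 0 \<le> p" "p \<noteq> Suc 0" "Suc 0 < p"
  using p_ge2 by auto

lemma Qpn_digit_less: "x \<in> Qpn p \<Longrightarrow> x i k < p"
  by (auto simp: Qpn_def padic_digits_def)

lemma Qpn_digit_zero: assumes "x \<in> Qpn p" obtains N where "\<And>i k. k < N \<Longrightarrow> x (i::'n::finite) k = 0"
proof -
  have "\<forall>i. \<exists>N. \<forall>k<N. x i k = 0"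
    using assms by (auto simp: Qpn_def padic_digits_def)
  then obtain N where N: "\<And>i k. k < N i \<Longrightarrow> x i k = 0" by metis
  have "x i k = 0" if "k < Min (range N)" for i k
    using that N[of k i] by (simp add: Min_gr_iff)
  then show ?thesis using that by blast
qed

lemma zero_in_Qpn [simp]: "(\<lambda>_ _. 0) \<in> Qpn p"
  using p_ge2 by (auto simp: Qpn_def padic_digits_def)

text \<open>The ball is encoded by the integers \<open>c i = \<lfloor>p\<^sup>-\<^sup>g t i\<rfloor>\<close> cutting out
  its preimage under the Monna map.\<close>

definition ball_code :: "int \<Rightarrow> ('n::finite \<Rightarrow> int \<Rightarrow> nat) \<Rightarrow> ('n \<Rightarrow> nat) \<Rightarrow> bool" where
  "ball_code g a c \<longleftrightarrow> (\<forall>i j. c i div p ^ j mod p = a i (- g - 1 - int j))"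

lemma ball_code_exists:
  assumes "a \<in> Qpn p" shows "\<exists>c. ball_code g a c"
proof -
  obtain N where N: "\<And>i k. k < N \<Longrightarrow> a i k = 0" using Qpn_digit_zero[OF assms] by blast
  \<comment> \<open>All digits at positions below \<open>N\<close> vanish, and
    \<open>- g - 1 - j < N\<close> as soon as \<open>j \<ge> - g - N\<close>; this bounds the length
    of the code.\<close>
  have "\<exists>n. \<forall>j. n div p ^ j mod p = a i (- g - 1 - int j)" for i
    by (rule digits_exist[OF p_ge2, where J = "nat (- g - N)"])
       (auto intro!: N Qpn_digit_less[OF assms])
  then show ?thesis unfolding ball_code_def by metis
qed

lemma all_below_iff: "(\<forall>k < - (g::int). P k) \<longleftrightarrow> (\<forall>j. P (- g - 1 - int j))"
proof (intro iffI allI impI)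
  fix k assume *: "\<forall>j. P (- g - 1 - int j)" "k < - g"
  then have "k = - g - 1 - int (nat (- g - 1 - k))" by auto
  then show "P k" using * by metis
qed auto

lemma pball_eq_code:
  assumes "ball_code g a c"
  shows "pball p g a = {x \<in> Qpn p. ball_code g x c}"
  using assms unfolding pball_def ball_code_def
  by (simp add: all_below_iff) (metis (lifting))

text \<open>By its code a ball is named by an integer and a function from a finite type to the
  naturals. Countability makes arbitrary unions of balls measurable and brings families of balls
  under countable additivity.\<close>

lemma countable_pballs: "countable (pballs p :: ('n::finite \<Rightarrow> int \<Rightarrow> nat) set set)"
proof -
  have "pballs p \<subseteq> range (\<lambda>(g::int, c::'n\<Rightarrow>nat). {x \<in> Qpn p. ball_code g x c})"
  proof
    fix B :: "('n \<Rightarrow> int \<Rightarrow> nat) set" assume "B \<in> pballs p"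
    then obtain g a where "B = pball p g a" "a \<in> Qpn p" by (auto simp: pballs_def)
    moreover obtain c where "ball_code g a c" using ball_code_exists[OF \<open>a \<in> Qpn p\<close>] by blast
    ultimately show "B \<in> range (\<lambda>(g::int, c::'n\<Rightarrow>nat). {x \<in> Qpn p. ball_code g x c})"
      using pball_eq_code by (auto intro!: image_eqI[of _ _ "(g, c)"])
  qed
  then show ?thesis by (rule countable_subset) simp
qed

section \<open>Preimages of balls under the Monna map\<close>

lemma monna_in_Qpn:
  assumes "\<forall>i. 0 \<le> t $ i" shows "monna p t \<in> Qpn p"
proof -
  have "\<exists>N. \<forall>k<N. monna p t i k = 0" for i
  proof (intro exI allI impI)
    fix k assume k: "k < - \<lceil>log (real p) (t $ i + 1)\<rceil>"
    have t: "0 \<le> t $ i" using assms by simp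
    \<comment> \<open>The \<open>1\<close> added to \<open>t $ i\<close> keeps the logarithm
      meaningful at \<open>t $ i = 0\<close> and makes the quotient
      \<open>t $ i / (t $ i + 1)\<close> less than one, so that the floor vanishes.\<close>
    have "real_of_int (k + 1) \<le> - log (real p) (t $ i + 1)" using k by linarith
    then have "real p powr real_of_int (k + 1) \<le> real p powr (- log (real p) (t $ i + 1))"
      by (intro powr_mono) auto
    also have "\<dots> = 1 / (t $ i + 1)" using t by (simp add: powr_minus_divide)
    finally have "t $ i * real p powr real_of_int (k + 1) \<le> t $ i * (1 / (t $ i + 1))"
      by (rule mult_left_mono) fact
    also have "\<dots> < 1" using t by simp
    finally have "\<lfloor>t $ i * real p powr real_of_int (k + 1)\<rfloor> \<le> 0" by linarith
    then show "monna p t i k = 0" by (simp add: monna_def)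
  qed
  moreover have "monna p t i k < p" for i k by (simp add: monna_def)
  ultimately show ?thesis by (auto simp: Qpn_def padic_digits_def)
qed

text \<open>Division by \<open>p ^ j\<close> commutes with the floor, so all digits at positions
  below \<open>- g\<close> are the base \<open>p\<close> digits of one natural number. Fixing these
  digits means fixing that number, which is why a ball pulls back to a cube.\<close>

lemma monna_digit:
  assumes "\<forall>i. 0 \<le> t $ i"
  shows "monna p t i (- g - 1 - int j) = nat \<lfloor>t $ i * real p powr - real_of_int g\<rfloor> div p ^ j mod p"
proof -
  have "real p powr real_of_int (- g - 1 - int j + 1) = real p powr - real_of_int g / real_of_int (int p ^ j)"
    using powr_diff[of "real p" "- real_of_int g" "real j"] by (simp add: powr_realpow)
  then have "\<lfloor>t $ i * real p powr real_of_int (- g - 1 - int j + 1)\<rfloor>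
      = \<lfloor>(t $ i * real p powr - real_of_int g) / real_of_int (int p ^ j)\<rfloor>"
    by (simp only: times_divide_eq_right)
  also have "\<dots> = \<lfloor>t $ i * real p powr - real_of_int g\<rfloor> div (int p ^ j)"
    by (rule floor_divide_real_eq_div) simp
  finally show ?thesis using assms
    by (simp add: monna_def nat_div_distrib nat_power_eq)
qed

lemma monna_in_pball_iff:
  assumes t: "\<forall>i. 0 \<le> t $ i" and c: "ball_code g a c"
  shows "monna p t \<in> pball p g a \<longleftrightarrow> (\<forall>i. nat \<lfloor>t $ i * real p powr - real_of_int g\<rfloor> = c i)"
proof -
  have "monna p t \<in> pball p g a \<longleftrightarrow>
      (\<forall>i j. nat \<lfloor>t $ i * real p powr - real_of_int g\<rfloor> div p ^ j mod p = c i div p ^ j mod p)"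
    using monna_in_Qpn[OF t] pball_eq_code[OF c] monna_digit[OF t]
    by (auto simp: ball_code_def)
  also have "\<dots> \<longleftrightarrow> (\<forall>i. nat \<lfloor>t $ i * real p powr - real_of_int g\<rfloor> = c i)"
    using digits_eqI[OF p_ge2] by metis
  finally show ?thesis .
qed

lemma nat_floor_scaled_eq_iff:
  assumes "0 \<le> s"
  shows "nat \<lfloor>s * real p powr - real_of_int g\<rfloor> = c \<longleftrightarrow>
    real c * real p powr real_of_int g \<le> s \<and> s < (real c + 1) * real p powr real_of_int g"
proof -
  have "nat \<lfloor>s * real p powr - real_of_int g\<rfloor> = c \<longleftrightarrow> \<lfloor>s * real p powr - real_of_int g\<rfloor> = int c"
    using assms by (auto simp: nat_eq_iff)
  also have "\<dots> \<longleftrightarrow> real c \<le> s * real p powr - real_of_int g \<and> s * real p powr - real_of_int g < real c + 1"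
    by (simp add: floor_eq_iff)
  also have "\<dots> \<longleftrightarrow> real c * real p powr real_of_int g \<le> s \<and> s < (real c + 1) * real p powr real_of_int g"
    by (simp add: powr_minus field_simps)
  finally show ?thesis .
qed

lemma monna_vimage_pball:
  assumes c: "ball_code g (a :: 'n::finite \<Rightarrow> int \<Rightarrow> nat) c"
  shows "monna p -` pball p g a \<inter> {t :: real^'n. \<forall>i. 0 \<le> t $ i} =
    {t. \<forall>i. real (c i) * real p powr real_of_int g \<le> t $ i \<and> t $ i < (real (c i) + 1) * real p powr real_of_int g}"
    (is "?L = ?R")
proof -
  have "t \<in> ?R \<Longrightarrow> 0 \<le> t $ i" for t i
    by (rule order_trans[of _ "real (c i) * real p powr real_of_int g"]) auto
  then show ?thesis
    using monna_in_pball_iff[OF _ c] nat_floor_scaled_eq_iff by auto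
qed

text \<open>The set lies between the open and the closed box with the same corners, and these have
  the same volume.\<close>

lemma half_open_box:
  fixes l u :: "'n::finite \<Rightarrow> real"
  assumes "\<And>i. l i \<le> u i"
  shows "{t :: real^'n. \<forall>i. l i \<le> t $ i \<and> t $ i < u i} \<in> sets borel"
    and "emeasure lborel {t :: real^'n. \<forall>i. l i \<le> t $ i \<and> t $ i < u i} = (\<Prod>i\<in>UNIV. u i - l i)"
proof -
  let ?S = "{t :: real^'n. \<forall>i. l i \<le> t $ i \<and> t $ i < u i}"
  show S: "?S \<in> sets borel" by measurable
  let ?l = "\<chi> i. l i" and ?u = "\<chi> i. u i"
  have le: "?l \<bullet> b \<le> ?u \<bullet> b" if "b \<in> Basis" for b
    using that assms by (auto simp: Basis_vec_def inner_axis)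
  have B: "(\<Prod>b\<in>Basis. (?u - ?l) \<bullet> b) = (\<Prod>i\<in>UNIV. u i - l i)"
  proof -
    have "inj (\<lambda>i::'n. axis i (1::real))" by (auto simp: inj_on_def axis_eq_axis)
    moreover have Basis: "(Basis :: (real^'n) set) = range (\<lambda>i. axis i 1)" by (auto simp: Basis_vec_def)
    ultimately show ?thesis unfolding Basis by (subst prod.reindex) (auto simp: inner_axis)
  qed
  have "emeasure lborel (box ?l ?u) \<le> emeasure lborel ?S"
    using S by (intro emeasure_mono) (auto simp: mem_box_cart less_imp_le)
  moreover have "emeasure lborel ?S \<le> emeasure lborel (cbox ?l ?u)"
    by (intro emeasure_mono) (auto simp: mem_box_cart less_imp_le)
  ultimately show "emeasure lborel ?S = (\<Prod>i\<in>UNIV. u i - l i)"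
    using le B by (simp add: emeasure_lborel_box emeasure_lborel_cbox)
qed

section \<open>Haar measure of balls\<close>

lemma pballs_Pow: "pballs p \<subseteq> Pow (Qpn p)"
  by (auto simp: pballs_def pball_def)

lemma space_haar [simp]: "space (haar p) = Qpn p"
  by (simp add: haar_def space_measure_of[OF pballs_Pow])

lemma sets_haar: "sets (haar p) = sigma_sets (Qpn p) (pballs p)"
  by (simp add: haar_def sets_measure_of[OF pballs_Pow])

lemma pballI [intro, simp]: "a \<in> Qpn p \<Longrightarrow> pball p g a \<in> pballs p"
  by (auto simp: pballs_def)

lemma pballs_sets: "B \<in> pballs p \<Longrightarrow> B \<in> sets (haar p)"
  unfolding sets_haar by blast

lemma sets_pball [measurable, simp]: "a \<in> Qpn p \<Longrightarrow> pball p g a \<in> sets (haar p)"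
  by (intro pballs_sets pballI)

lemma monna_measurable:
  "monna p \<in> measurable (restrict_space lborel {t :: real^'n::finite. \<forall>i. 0 \<le> t $ i}) (sigma (Qpn p) (pballs p))"
proof (rule measurable_measure_of[OF pballs_Pow])
  show "monna p \<in> space (restrict_space lborel {t :: real^'n. \<forall>i. 0 \<le> t $ i}) \<rightarrow> Qpn p"
    by (auto simp: space_restrict_space monna_in_Qpn)
  fix B :: "('n \<Rightarrow> int \<Rightarrow> nat) set" assume "B \<in> pballs p"
  then obtain g a where B: "B = pball p g a" "a \<in> Qpn p" by (auto simp: pballs_def)
  obtain c where c: "ball_code g a c" using ball_code_exists[OF B(2)] by blast
  have O: "{t :: real^'n. \<forall>i. 0 \<le> t $ i} \<in> sets borel" by measurable
  show "monna p -` B \<inter> space (restrict_space lborel {t :: real^'n. \<forall>i. 0 \<le> t $ i})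
      \<in> sets (restrict_space lborel {t :: real^'n. \<forall>i. 0 \<le> t $ i})"
    unfolding B space_restrict_space space_lborel Int_UNIV_right monna_vimage_pball[OF c]
    using O half_open_box(1)[of "\<lambda>i. real (c i) * real p powr real_of_int g" "\<lambda>i. (real (c i) + 1) * real p powr real_of_int g"]
      monna_vimage_pball[OF c]
    by (subst sets_restrict_space_iff) (auto simp: mult_right_mono)
qed

lemma emeasure_pball:
  assumes a: "a \<in> Qpn p"
  shows "emeasure (haar p) (pball p g (a :: 'n::finite \<Rightarrow> int \<Rightarrow> nat)) = ennreal (real p powr (real CARD('n) * real_of_int g))"
proof -
  obtain c where c: "ball_code g a c" using ball_code_exists[OF a] by blast
  let ?O = "{t :: real^'n. \<forall>i. 0 \<le> t $ i}"
  have O: "?O \<in> sets borel" by measurable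
  have "emeasure (haar p) (pball p g a) = emeasure (restrict_space lborel ?O) (monna p -` pball p g a \<inter> ?O)"
    unfolding haar_def using sets_pball[OF a, unfolded sets_haar]
    by (subst emeasure_distr[OF monna_measurable]) (simp_all add: space_restrict_space pballs_Pow sets_measure_of)
  also have "\<dots> = emeasure lborel (monna p -` pball p g a \<inter> ?O)"
    using O by (subst emeasure_restrict_space) auto
  also have "\<dots> = ennreal (\<Prod>i\<in>(UNIV::'n set). real p powr real_of_int g)"
    unfolding monna_vimage_pball[OF c]
    by (subst half_open_box(2)) (auto simp: algebra_simps)
  also have "(\<Prod>i\<in>(UNIV::'n set). real p powr real_of_int g) = real p powr (real CARD('n) * real_of_int g)"
    by (simp add: powr_power mult.commute)
  finally show ?thesis .
qed

lemma measure_pball: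
  assumes a: "a \<in> Qpn p"
  shows "measure (haar p) (pball p g (a :: 'n::finite \<Rightarrow> int \<Rightarrow> nat)) = real p powr (real CARD('n) * real_of_int g)"
  by (simp add: measure_def emeasure_pball[OF a])

lemma pball_self [simp]: "a \<in> Qpn p \<Longrightarrow> a \<in> pball p g a"
  by (simp add: pball_def)

section \<open>Ultrametric geometry, norms and spheres\<close>

lemma pball_subset_Qpn: "pball p g a \<subseteq> Qpn p"
  by (auto simp: pball_def)

text \<open>Every point of a ball is a centre of it: a ball remembers of its centre only the digits
  below position \<open>- g\<close>, and its points share them.\<close>

lemma pball_eqI: "x \<in> pball p g a \<Longrightarrow> pball p g x = pball p g a"
  by (auto simp: pball_def)

lemma pball_mono: "g \<le> h \<Longrightarrow> pball p g a \<subseteq> pball p h a"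
  by (auto simp: pball_def)

lemma pball_subset: "x \<in> pball p h a \<Longrightarrow> g \<le> h \<Longrightarrow> pball p g x \<subseteq> pball p h a"
  using pball_mono[of g h x] pball_eqI[of x h a] by simp

lemma pballs_E:
  assumes "B \<in> pballs p" obtains g a where "a \<in> Qpn p" "B = pball p g a"
  using assms by (auto simp: pballs_def)

lemma padic_abs_le_iff:
  assumes d: "d \<in> padic_digits p"
  shows "padic_abs p d \<le> real p powr real_of_int g \<longleftrightarrow> (\<forall>k < -g. d k = 0)"
proof (cases "\<forall>k. d k = 0")
  case False
  then obtain k0 where k0: "d k0 \<noteq> 0" by blast
  obtain N where N: "\<And>k. k < N \<Longrightarrow> d k = 0" using d by (auto simp: padic_digits_def)
  \<comment> \<open>The integers are not well-founded, so the first nonzero digit is sought as a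
    natural offset from \<open>N\<close>, below which all digits vanish.\<close>
  define n where "n = (LEAST n. d (N + int n) \<noteq> 0)"
  have "N + int (nat (k0 - N)) = k0" using N[of k0] k0 by force
  then have ex: "d (N + int (nat (k0 - N))) \<noteq> 0" using k0 by simp
  have n: "d (N + int n) \<noteq> 0" unfolding n_def by (rule LeastI, rule ex)
  have least: "d k = 0" if "k < N + int n" for k
  proof (cases "k < N")
    case False
    then have "nat (k - N) < n" using that by linarith
    then have "d (N + int (nat (k - N))) = 0" unfolding n_def using not_less_Least by blast
    then show ?thesis using False by simp
  qed (rule N)
  have "pord d = N + int n"
    unfolding pord_def
  proof (rule the_equality)
    fix k assume k: "d k \<noteq> 0 \<and> (\<forall>j<k. d j = 0)"
    show "k = N + int n"
    proof (rule linorder_cases[of k "N + int n"])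
      assume "k < N + int n" then show ?thesis using least[of k] k by simp
    next
      assume "N + int n < k"
      then have "d (N + int n) = 0" using k by simp
      then show ?thesis using n by simp
    qed
  qed (use n least in blast)
  then have "padic_abs p d \<le> real p powr real_of_int g \<longleftrightarrow> - (N + int n) \<le> g"
    using False by (simp only: padic_abs_def powr_le_cancel_iff[OF p_pos(2)] of_int_le_iff of_int_minus[symmetric] if_False)
  also have "\<dots> \<longleftrightarrow> (\<forall>k < -g. d k = 0)"
  proof
    assume "- (N + int n) \<le> g" then show "\<forall>k < -g. d k = 0" using least by auto
  next
    assume "\<forall>k < -g. d k = 0"
    then have "\<not> N + int n < - g" using n by (metis (no_types))
    then show "- (N + int n) \<le> g" by linarith
  qed
  finally show ?thesis .
qed (simp add: padic_abs_def)

lemma vnorm_le_iff: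
  assumes "x \<in> Qpn p"
  shows "vnorm p (x :: 'n::finite \<Rightarrow> int \<Rightarrow> nat) \<le> real p powr real_of_int g \<longleftrightarrow> (\<forall>i. \<forall>k < -g. x i k = 0)"
proof -
  have "vnorm p x \<le> real p powr real_of_int g \<longleftrightarrow> (\<forall>i. padic_abs p (x i) \<le> real p powr real_of_int g)"
    by (simp add: vnorm_def)
  then show ?thesis using assms padic_abs_le_iff by (auto simp: Qpn_def)
qed

lemma Bg_eq_pball: "Bg p g = pball p g (\<lambda>_ _. 0)"
  using vnorm_le_iff by (auto simp: Bg_def pball_def)

lemma Bg_pballs [simp]: "Bg p g \<in> pballs p"
  by (simp add: Bg_eq_pball)

lemma sets_Bg [measurable, simp]: "Bg p g \<in> sets (haar p)"
  by (simp add: Bg_eq_pball)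

lemma Bg_mono: "g \<le> h \<Longrightarrow> Bg p g \<subseteq> Bg p h"
  unfolding Bg_eq_pball by (rule pball_mono)

lemma emeasure_Bg:
  "emeasure (haar p) (Bg p g :: ('n::finite \<Rightarrow> int \<Rightarrow> nat) set) = ennreal (real p powr (real CARD('n) * real_of_int g))"
  unfolding Bg_eq_pball by (rule emeasure_pball) simp

lemma pball_subset_Bg:
  assumes "a \<in> Qpn p"
  obtains h where "pball p g a \<subseteq> Bg p h"
proof -
  obtain N where N: "\<And>i k. k < N \<Longrightarrow> a i k = 0" using Qpn_digit_zero[OF assms] by blast
  \<comment> \<open>Radius exponent \<open>- N\<close> puts \<open>a\<close> into the ball about the
    origin; the maximum also makes that ball at least as large as the given one.\<close>
  define h where "h = max g (- N)"
  have "a \<in> Bg p h" using assms N by (auto simp: Bg_eq_pball pball_def h_def)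
  then have "pball p h a = Bg p h" unfolding Bg_eq_pball by (rule pball_eqI)
  moreover have "pball p g a \<subseteq> pball p h a" by (rule pball_mono) (simp add: h_def)
  ultimately show ?thesis using that[of h] by simp
qed

lemma padic_abs_values:
  "padic_abs p d = 0 \<or> (\<exists>v. padic_abs p d = real p powr real_of_int v)"
  by (auto simp: padic_abs_def intro!: exI[of _ "- pord d"])

lemma vnorm_values:
  "vnorm p (x :: 'n::finite \<Rightarrow> int \<Rightarrow> nat) = 0 \<or> (\<exists>v. vnorm p x = real p powr real_of_int v)"
proof -
  have "vnorm p x \<in> range (\<lambda>i. padic_abs p (x i))"
    unfolding vnorm_def by (rule Max_in) auto
  then show ?thesis using padic_abs_values by (metis imageE)
qed

lemma vexp_eq: "vnorm p x = real p powr real_of_int v \<Longrightarrow> vexp p x = v"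
  by (simp add: vexp_def)

lemma vexp_Sg: "x \<in> Sg p v \<Longrightarrow> vexp p x = v \<and> vnorm p x \<noteq> 0"
  using vexp_eq by (auto simp: Sg_def)

lemma Sg_vexp: "x \<in> Qpn p \<Longrightarrow> vnorm p x \<noteq> 0 \<Longrightarrow> x \<in> Sg p (vexp p x)"
  using vnorm_values[of x] vexp_eq[of x] by (auto simp: Sg_def)

text \<open>Norm values are zero or integer powers of \<open>p\<close>, so none lies strictly
  between \<open>p^(g - 1)\<close> and \<open>p^g\<close>.\<close>

lemma Sg_eq_diff: "Sg p g = Bg p g - Bg p (g - 1)"
proof -
  have "vnorm p x = real p powr real_of_int g \<longleftrightarrow>
     vnorm p x \<le> real p powr real_of_int g \<and> \<not> vnorm p x \<le> real p powr real_of_int (g - 1)"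
    for x :: "'n::finite \<Rightarrow> int \<Rightarrow> nat"
    using vnorm_values[of x]
  proof
    assume "vnorm p x = 0"
    then show ?thesis by simp
  next
    assume "\<exists>v. vnorm p x = real p powr real_of_int v"
    then obtain v where v: "vnorm p x = real p powr real_of_int v" ..
    show ?thesis unfolding v by (auto simp del: of_int_diff simp: powr_inj)
  qed
  then show ?thesis by (auto simp: Sg_def Bg_def)
qed

lemma sets_Sg [measurable, simp]: "Sg p g \<in> sets (haar p)"
  by (simp add: Sg_eq_diff sets.Diff)

lemma Sg_subset_Bg: "Sg p g \<subseteq> Bg p g"
  by (auto simp: Sg_eq_diff)

text \<open>Only the origin has norm zero, and it lies in every \<open>Bg p (- k)\<close>, whose
  measures tend to zero. This justifies cutting integrals over balls into spheres.\<close>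

lemma null_vnorm_zero: "{x \<in> Qpn p. vnorm p x = 0} \<in> null_sets (haar p :: ('n::finite \<Rightarrow> int \<Rightarrow> nat) measure)"
proof -
  let ?Z = "{x :: 'n \<Rightarrow> int \<Rightarrow> nat. x \<in> Qpn p \<and> vnorm p x = 0}"
  have "?Z = Qpn p - (\<Union>v. Sg p v)"
    using vexp_Sg Sg_vexp by fastforce
  moreover have "Qpn p \<in> sets (haar p :: ('n \<Rightarrow> int \<Rightarrow> nat) measure)"
    using sets.top[of "haar p :: ('n \<Rightarrow> int \<Rightarrow> nat) measure"] by simp
  ultimately have Z: "?Z \<in> sets (haar p)" by auto
  have le: "emeasure (haar p) ?Z \<le> ennreal (real p powr (real CARD('n) * real_of_int (- int k)))" for k
    unfolding emeasure_Bg[symmetric] by (rule emeasure_mono[OF _ sets_Bg]) (auto simp: Bg_def)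
  have "(\<lambda>k. (1 / real p powr real CARD('n)) ^ k) \<longlonglongrightarrow> 0"
    by (rule LIMSEQ_power_zero) (simp add: powr_realpow one_less_power)
  moreover have "(1 / real p powr real CARD('n)) ^ k = real p powr (real CARD('n) * real_of_int (- int k))" for k
    by (simp add: powr_minus powr_power power_one_over inverse_eq_divide mult.commute)
  ultimately have "(\<lambda>k. ennreal (real p powr (real CARD('n) * real_of_int (- int k)))) \<longlonglongrightarrow> ennreal 0"
    by (intro tendsto_ennrealI) simp
  then have "emeasure (haar p) ?Z \<le> ennreal 0"
    by (rule LIMSEQ_le_const) (use le in auto)
  then show ?thesis using Z by (auto simp: null_sets_def)
qed

subsection \<open>Dilations\<close>

lemma pdil_Qpn [simp]: "x \<in> Qpn p \<Longrightarrow> pdil j x \<in> Qpn p"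
proof -
  assume x: "x \<in> Qpn p"
  have "\<exists>N. \<forall>k<N. x i (k - j) = 0" for i
  proof -
    obtain N where "\<And>i k. k < N \<Longrightarrow> x i k = 0" using Qpn_digit_zero[OF x] by blast
    then show ?thesis by (intro exI[of _ "N + j"]) auto
  qed
  then show ?thesis using x by (auto simp: Qpn_def padic_digits_def pdil_def)
qed

lemma pdil_vimage_pball: "pdil j -` pball p g a \<inter> Qpn p = pball p (g + j) (pdil (- j) a)"
proof -
  have "(\<forall>i k. k < - g \<longrightarrow> x i (k - j) = a i k) \<longleftrightarrow> (\<forall>i k. k < - (g + j) \<longrightarrow> x i k = a i (k + j))" for x
  proof (intro iffI allI impI)
    fix i k assume "\<forall>i k. k < - g \<longrightarrow> x i (k - j) = a i k" "k < - (g + j)"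
    then show "x i k = a i (k + j)" by (auto dest!: spec[of _ i] spec[of _ "k + j"])
  next
    fix i k assume "\<forall>i k. k < - (g + j) \<longrightarrow> x i k = a i (k + j)" "k < - g"
    then show "x i (k - j) = a i k" by (auto dest!: spec[of _ i] spec[of _ "k - j"])
  qed
  then show ?thesis using pdil_Qpn[of _ j] unfolding pball_def pdil_def by auto
qed

lemma pdil_measurable [measurable]: "pdil j \<in> measurable (haar p) (haar p)"
proof (rule measurable_sigma_sets[OF sets_haar pballs_Pow])
  show "pdil j \<in> space (haar p) \<rightarrow> Qpn p" by auto
  fix B assume "B \<in> pballs p"
  then obtain g a where "a \<in> Qpn p" "B = pball p g a" by (rule pballs_E)
  then show "pdil j -` B \<inter> space (haar p) \<in> sets (haar p)" by (simp add: pdil_vimage_pball)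
qed

text \<open>Two balls with a common point are balls about that point, hence nested. The empty set is
  adjoined for disjoint pairs.\<close>

lemma Int_stable_pballs: "Int_stable (insert {} (pballs p))"
proof (rule Int_stableI)
  fix A B :: "('n::finite \<Rightarrow> int \<Rightarrow> nat) set"
  assume AB: "A \<in> insert {} (pballs p)" "B \<in> insert {} (pballs p)"
  show "A \<inter> B \<in> insert {} (pballs p)"
  proof (cases "A \<inter> B = {}")
    case False
    then obtain x where x: "x \<in> A" "x \<in> B" by blast
    then obtain g a h b where A: "A = pball p g a" and B: "B = pball p h b"
      using AB by (auto simp: pballs_def)
    have "A = pball p g x" "B = pball p h x" using x pball_eqI A B by metis+
    then have "A \<inter> B = A \<or> A \<inter> B = B" using pball_mono[of g h x] pball_mono[of h g x] by (cases "g \<le> h") auto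
    then show ?thesis using AB by auto
  qed simp
qed

lemma sigma_sets_insert_empty: "sigma_sets \<Omega> (insert {} E) = sigma_sets \<Omega> E"
  by (intro antisym sigma_sets_mono) (auto intro: sigma_sets.intros)

text \<open>Multiplication by \<open>p^j\<close> divides the norm by \<open>p^j\<close>, so the
  preimage of a ball has \<open>j\<close> added to its radius exponent and its measure multiplied by
  \<open>p^(n j)\<close>. Balls form an intersection-stable generator and a countable cover by sets
  of finite measure, so agreement on them is enough.\<close>

lemma distr_pdil:
  "distr (haar p) (haar p) (pdil j :: ('n::finite \<Rightarrow> int \<Rightarrow> nat) \<Rightarrow> _)
    = scale_measure (ennreal (real p powr (real CARD('n) * real_of_int j))) (haar p)"
proof (rule measure_eqI_generator_eq_countable[OF Int_stable_pballs, where \<Omega> = "Qpn p" and A = "pballs p"])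
  show "insert {} (pballs p) \<subseteq> Pow (Qpn p)" using pballs_Pow by auto
  fix X :: "('n \<Rightarrow> int \<Rightarrow> nat) set" assume "X \<in> insert {} (pballs p)"
  then show "emeasure (distr (haar p) (haar p) (pdil j)) X
     = emeasure (scale_measure (ennreal (real p powr (real CARD('n) * real_of_int j))) (haar p)) X"
  proof
    assume "X \<in> pballs p"
    then obtain g a where X: "a \<in> Qpn p" "X = pball p g a" by (rule pballs_E)
    then show ?thesis
      by (simp add: emeasure_distr pdil_vimage_pball emeasure_pball flip: ennreal_mult' powr_add)
         (simp add: algebra_simps)
  qed simp
next
  show "\<Union>(pballs p) = Qpn p" using pballs_Pow pball_self by blast
  fix a :: "('n \<Rightarrow> int \<Rightarrow> nat) set" assume "a \<in> pballs p"
  then obtain g b where X: "b \<in> Qpn p" "a = pball p g b" by (rule pballs_E)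
  then show "emeasure (distr (haar p) (haar p) (pdil j)) a \<noteq> \<infinity>"
    by (simp add: emeasure_distr pdil_vimage_pball emeasure_pball)
qed (auto simp: sigma_sets_insert_empty sets_haar countable_pballs)

lemma nn_integral_pdil:
  fixes u :: "('n::finite \<Rightarrow> int \<Rightarrow> nat) \<Rightarrow> ennreal"
  assumes [measurable]: "u \<in> borel_measurable (haar p)"
  shows "(\<integral>\<^sup>+ y. u (pdil j y) \<partial>haar p) = ennreal (real p powr (real CARD('n) * real_of_int j)) * (\<integral>\<^sup>+ y. u y \<partial>haar p)"
proof -
  have "(\<integral>\<^sup>+ y. u (pdil j y) \<partial>haar p) = (\<integral>\<^sup>+ y. u y \<partial>distr (haar p) (haar p) (pdil j))"
    by (rule nn_integral_distr[symmetric]) auto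
  then show ?thesis by (simp add: distr_pdil nn_integral_scale_measure)
qed

lemma pdil_Bg: "y \<in> Bg p h \<Longrightarrow> pdil j y \<in> Bg p (h - j)"
proof -
  assume "y \<in> Bg p h"
  then have "y \<in> pdil j -` pball p (h - j) (\<lambda>_ _. 0) \<inter> Qpn p"
    unfolding pdil_vimage_pball by (simp add: Bg_eq_pball pdil_def)
  then show ?thesis by (simp add: Bg_eq_pball)
qed

subsection \<open>Approximation by unions of balls\<close>

text \<open>Sets determined by the digits below position \<open>- g\<close>; they become a finer
  means of approximation as \<open>g\<close> decreases.\<close>

definition level :: "int \<Rightarrow> ('n::finite \<Rightarrow> int \<Rightarrow> nat) set \<Rightarrow> bool" where
  "level g A \<longleftrightarrow> A \<subseteq> Qpn p \<and> (\<forall>x\<in>A. pball p g x \<subseteq> A)"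

lemma level_mono: "level g A \<Longrightarrow> h \<le> g \<Longrightarrow> level h A"
  using pball_mono unfolding level_def by blast

text \<open>There are only countably many balls, so the union of all those contained in
  \<open>A\<close> is measurable, however many points \<open>A\<close> has.\<close>

lemma sets_union_of_balls:
  assumes "A \<subseteq> Qpn p" "\<And>x. x \<in> A \<Longrightarrow> \<exists>g. pball p g x \<subseteq> A"
  shows "A \<in> sets (haar p)"
proof -
  have "x \<in> \<Union>{B \<in> pballs p. B \<subseteq> A}" if "x \<in> A" for x
  proof -
    obtain g where "pball p g x \<subseteq> A" using assms(2)[OF \<open>x \<in> A\<close>] by blast
    moreover have "x \<in> Qpn p" using assms(1) that by blast
    ultimately show ?thesis by (intro UnionI[of "pball p g x"]) auto
  qed
  then have "A = \<Union>{B \<in> pballs p. B \<subseteq> A}" by blast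
  moreover have "\<Union>{B \<in> pballs p. B \<subseteq> A} \<in> sets (haar p)"
    by (rule sets.countable_Union)
       (auto intro: pballs_sets countable_subset[OF _ countable_pballs])
  ultimately show ?thesis by simp
qed

lemma level_sets: "level g A \<Longrightarrow> A \<in> sets (haar p)"
  by (rule sets_union_of_balls) (auto simp: level_def)

lemma level_compl: assumes "level g A" shows "level g (Qpn p - A)"
proof -
  have "y \<notin> A" if "x \<in> Qpn p" "x \<notin> A" "y \<in> pball p g x" for x y
  proof
    assume "y \<in> A"
    then have "pball p g y \<subseteq> A" using assms by (auto simp: level_def)
    then show False using pball_eqI[OF that(3)] pball_self[OF that(1)] that(2) by blast
  qed
  then show ?thesis using pball_subset_Qpn unfolding level_def by blast
qed

text \<open>Induction over the generation of the sigma-algebra. The finite measure is left arbitrary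
  because one approximating set will have to work for Haar measure and for the weighted measure at
  once.\<close>

lemma approx_by_level_sets:
  fixes M :: "('n::finite \<Rightarrow> int \<Rightarrow> nat) measure"
  assumes "finite_measure M" and sets: "sets M = sets (haar p)"
    and A: "A \<in> sets (haar p)" and e: "0 < e"
  shows "\<exists>g D. level g D \<and> measure M ((A - D) \<union> (D - A)) \<le> e"
proof -
  interpret finite_measure M by fact
  have space: "space M = Qpn p" using sets_eq_imp_space_eq[OF sets] by simp
  from A have "A \<in> sigma_sets (Qpn p) (pballs p)" by (simp add: sets_haar)
  then show ?thesis using e
  proof (induction arbitrary: e)
    case (Basic B)
    then obtain g a where "a \<in> Qpn p" "B = pball p g a" by (auto elim: pballs_E)
    then have "level g B" using pball_eqI pball_subset_Qpn unfolding level_def by blast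
    then show ?case using Basic by (intro exI[of _ g] exI[of _ B]) simp
  next
    case Empty
    then show ?case by (intro exI[of _ 0] exI[of _ "{}"]) (simp add: level_def)
  next
    case (Compl B)
    then obtain g D where D: "level g D" "measure M ((B - D) \<union> (D - B)) \<le> e" by blast
    have "B \<subseteq> Qpn p" using Compl.hyps sets.sets_into_space[of B "haar p"] by (simp add: sets_haar)
    then have "((Qpn p - B) - (Qpn p - D)) \<union> ((Qpn p - D) - (Qpn p - B)) = (B - D) \<union> (D - B)"
      using D(1) by (auto simp: level_def)
    then show ?case using D level_compl by metis
  next
    case (Union B)
    have B [measurable]: "B i \<in> sets M" for i using Union.hyps by (simp add: sets sets_haar)
    \<comment> \<open>The union is first cut to finitely many sets, because the levels of infinitely
      many approximants need not have a minimum.\<close>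
    let ?U = "\<lambda>N. \<Union>i<N. B i"
    have "(\<lambda>N. measure M (?U N)) \<longlonglongrightarrow> measure M (\<Union>N. ?U N)"
      by (rule finite_Lim_measure_incseq) (auto simp: incseq_def intro: order_less_le_trans)
    moreover have "(\<Union>N. ?U N) = (\<Union>i. B i)" by auto
    ultimately have "(\<lambda>N. measure M (?U N)) \<longlonglongrightarrow> measure M (\<Union>i. B i)" by simp
    then have "\<forall>\<^sub>F N in sequentially. dist (measure M (?U N)) (measure M (\<Union>i. B i)) < e / 2"
      by (rule tendstoD[OF _ half_gt_zero[OF Union.prems]])
    then obtain N where N: "dist (measure M (?U N)) (measure M (\<Union>i. B i)) < e / 2"
      by (meson eventually_happens sequentially_bot)
    have tail: "measure M ((\<Union>i. B i) - ?U N) \<le> e / 2"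
    proof -
      have "measure M ((\<Union>i. B i) - ?U N) = measure M (\<Union>i. B i) - measure M (?U N)"
        by (rule finite_measure_Diff) auto
      then show ?thesis using N unfolding dist_real_def by linarith
    qed
    \<comment> \<open>Half of \<open>e\<close> pays for the cut, the other half is shared by the
      \<open>N\<close> approximations; \<open>Suc N\<close> avoids a zero denominator.\<close>
    define \<eta> where "\<eta> = e / (2 * real (Suc N))"
    have "\<eta> > 0" using Union.prems by (simp add: \<eta>_def)
    then have "\<forall>i. \<exists>g D. level g D \<and> measure M ((B i - D) \<union> (D - B i)) \<le> \<eta>"
      using Union.IH by blast
    then obtain g D where D: "\<And>i. level (g i) (D i)" "\<And>i. measure M ((B i - D i) \<union> (D i - B i)) \<le> \<eta>"
      by metis
    have Ds [measurable]: "D i \<in> sets M" for i using level_sets[OF D(1)] by (simp add: sets)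
    let ?D = "\<Union>i<N. D i"
    define h where "h = (if N = 0 then 0 else Min (g ` {..<N}))"
    have "level h (D i)" if "i < N" for i
      using that by (intro level_mono[OF D(1)]) (auto simp: h_def)
    then have lev: "level h ?D" by (fastforce simp: level_def)
    have "measure M (((\<Union>i. B i) - ?D) \<union> (?D - (\<Union>i. B i)))
        \<le> measure M (((\<Union>i. B i) - ?U N) \<union> (\<Union>i<N. (B i - D i) \<union> (D i - B i)))"
      by (intro finite_measure_mono) auto
    also have "\<dots> \<le> measure M ((\<Union>i. B i) - ?U N) + measure M (\<Union>i<N. (B i - D i) \<union> (D i - B i))"
      by (intro measure_Un_le) auto
    also have "measure M (\<Union>i<N. (B i - D i) \<union> (D i - B i)) \<le> (\<Sum>i<N. measure M ((B i - D i) \<union> (D i - B i)))"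
      by (intro measure_UNION_le) auto
    also have "\<dots> \<le> (\<Sum>i<N. \<eta>)" by (intro sum_mono D)
    also have "\<dots> \<le> e / 2" using Union.prems by (simp add: \<eta>_def field_simps)
    finally show ?case using tail lev by (intro exI[of _ h] exI[of _ ?D]) auto
  qed
qed

text \<open>Countable additivity over disjoint balls. Two measures and two sets are allowed so that
  the lemma compares Haar measure and weighted measure in either direction and also gives the decay
  of the weighted measure along shrinking sets.\<close>

lemma emeasure_le_on_balls:
  assumes Q: "Q \<subseteq> pballs p" "disjoint Q" and sets: "sets M = sets (haar p)" "sets N = sets (haar p)"
    and XY [measurable]: "X \<in> sets (haar p)" "Y \<in> sets (haar p)"
    and le: "\<And>B. B \<in> Q \<Longrightarrow> emeasure M (X \<inter> B) \<le> c * emeasure N (Y \<inter> B)"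
  shows "emeasure M (X \<inter> \<Union>Q) \<le> c * emeasure N (Y \<inter> \<Union>Q)"
proof -
  have cQ: "countable Q" using Q(1) countable_pballs countable_subset by blast
  have dis: "disjoint_family_on (\<lambda>B. Z \<inter> B) Q" for Z :: "('a \<Rightarrow> int \<Rightarrow> nat) set"
    using Q(2) by (fastforce simp: disjoint_family_on_def disjoint_def)
  have QM: "B \<in> sets M" "B \<in> sets N" if "B \<in> Q" for B using that Q(1) pballs_sets sets by auto
  have X: "X \<in> sets M" and Y: "Y \<in> sets N" using sets XY by auto
  have "emeasure M (X \<inter> \<Union>Q) = emeasure M (\<Union>B\<in>Q. X \<inter> B)" by (simp only: Int_Union)
  also have "\<dots> = (\<integral>\<^sup>+ B. emeasure M (X \<inter> B) \<partial>count_space Q)"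
    using cQ dis QM X by (intro emeasure_UN_countable) auto
  also have "\<dots> \<le> (\<integral>\<^sup>+ B. c * emeasure N (Y \<inter> B) \<partial>count_space Q)"
    using le by (intro nn_integral_mono) auto
  also have "\<dots> = c * (\<integral>\<^sup>+ B. emeasure N (Y \<inter> B) \<partial>count_space Q)"
    by (rule nn_integral_cmult) simp
  also have "(\<integral>\<^sup>+ B. emeasure N (Y \<inter> B) \<partial>count_space Q) = emeasure N (\<Union>B\<in>Q. Y \<inter> B)"
    using cQ dis QM Y by (intro emeasure_UN_countable[symmetric]) auto
  also have "(\<Union>B\<in>Q. Y \<inter> B) = Y \<inter> \<Union>Q" by blast
  finally show ?thesis .
qed

end

subsection \<open>Hoelder's inequality and Muckenhoupt weights\<close>

text \<open>Jensen's inequality for the concave logarithm; a vanishing factor, out of reach of the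
  logarithm, makes the left side zero.\<close>

lemma weighted_arith_geom_mean:
  fixes a x :: "'i \<Rightarrow> real"
  assumes I: "finite I" and a: "\<And>i. i \<in> I \<Longrightarrow> 0 < a i" "(\<Sum>i\<in>I. a i) = 1"
    and x: "\<And>i. i \<in> I \<Longrightarrow> 0 \<le> x i"
  shows "(\<Prod>i\<in>I. x i powr a i) \<le> (\<Sum>i\<in>I. a i * x i)"
proof (cases "\<exists>i\<in>I. x i = 0")
  case True
  then have "(\<Prod>i\<in>I. x i powr a i) = 0" using I by (auto intro!: prod_zero)
  also have "0 \<le> (\<Sum>i\<in>I. a i * x i)" using a x by (intro sum_nonneg) (simp add: less_imp_le)
  finally show ?thesis .
next
  case False
  then have pos: "\<And>i. i \<in> I \<Longrightarrow> 0 < x i" using x by (metis less_le)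
  have ne: "I \<noteq> {}" using a(2) by auto
  have "(\<Sum>i\<in>I. a i * ln (x i)) \<le> ln (\<Sum>i\<in>I. a i *\<^sub>R x i)"
    using I ne a pos by (intro concave_on_sum[OF _ _ ln_concave]) (auto intro: less_imp_le)
  moreover have "0 < (\<Sum>i\<in>I. a i *\<^sub>R x i)" using I ne a pos by (auto intro!: sum_pos)
  ultimately have "exp (\<Sum>i\<in>I. a i * ln (x i)) \<le> (\<Sum>i\<in>I. a i *\<^sub>R x i)"
    by (simp add: ln_ge_iff)
  moreover have "exp (\<Sum>i\<in>I. a i * ln (x i)) = (\<Prod>i\<in>I. x i powr a i)"
    using I pos by (auto simp: exp_sum powr_def intro!: prod.cong dest: pos)
  ultimately show ?thesis by simp
qed

text \<open>Each factor is divided by its integral and the mean inequality is applied pointwise; the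
  resulting bound integrates to the sum of the \<open>a i\<close>, which is one. The same pointwise
  bound gives the integrability of the product.\<close>

lemma Holder_prod:
  fixes G :: "'i \<Rightarrow> 'a \<Rightarrow> real"
  assumes I: "finite I" and a: "\<And>i. i \<in> I \<Longrightarrow> 0 < a i" "(\<Sum>i\<in>I. a i) = 1"
    and int: "\<And>i. i \<in> I \<Longrightarrow> integrable M (G i)" and nn: "\<And>i x. i \<in> I \<Longrightarrow> 0 \<le> G i x"
  shows "integrable M (\<lambda>x. \<Prod>i\<in>I. G i x powr a i)"
    and "(\<integral>x. (\<Prod>i\<in>I. G i x powr a i) \<partial>M) \<le> (\<Prod>i\<in>I. (\<integral>x. G i x \<partial>M) powr a i)"
proof -
  define c where "c i = (\<integral>x. G i x \<partial>M)" for i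
  have c0: "0 \<le> c i" if "i \<in> I" for i unfolding c_def using nn that by (simp add: integral_nonneg_AE)
  have [measurable]: "G i \<in> borel_measurable M" if "i \<in> I" for i using int that by auto
  let ?P = "\<lambda>x. \<Prod>i\<in>I. G i x powr a i"
  have meas [measurable]: "?P \<in> borel_measurable M" by (intro borel_measurable_prod) measurable
  have "integrable M ?P \<and> (\<integral>x. ?P x \<partial>M) \<le> (\<Prod>i\<in>I. c i powr a i)"
  \<comment> \<open>A factor with zero integral cannot be normalised, but it vanishes almost
    everywhere, and with it the product.\<close>
  proof (cases "\<exists>i\<in>I. c i = 0")
    case True
    then obtain i where i: "i \<in> I" "c i = 0" by blast
    then have "AE x in M. G i x = 0"
      using integral_nonneg_eq_0_iff_AE[OF int[OF i(1)]] nn by (auto simp: c_def)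
    then have ae: "AE x in M. ?P x = 0" by eventually_elim (use i I in \<open>auto intro!: prod_zero\<close>)
    have "integrable M ?P" using integrable_cong_AE[OF meas _ ae] by simp
    moreover have "(\<integral>x. ?P x \<partial>M) = 0" using integral_cong_AE[OF meas _ ae] by simp
    moreover have "0 \<le> (\<Prod>i\<in>I. c i powr a i)" by (intro prod_nonneg) auto
    ultimately show ?thesis by simp
  next
    case False
    then have pos: "0 < c i" if "i \<in> I" for i using c0 that by (metis less_le)
    define C where "C = (\<Prod>i\<in>I. c i powr a i)"
    have C: "0 < C" unfolding C_def by (intro prod_pos) (auto dest: pos)
    define h where "h x = C * (\<Sum>i\<in>I. a i * (G i x / c i))" for x
    have le: "?P x \<le> h x" for x
    proof -
      have "?P x = C * (\<Prod>i\<in>I. (G i x / c i) powr a i)"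
        unfolding C_def prod.distrib[symmetric] using pos nn
        by (intro prod.cong) (auto simp: powr_divide less_imp_le dest: pos)
      also have "\<dots> \<le> h x" unfolding h_def using C pos nn
        by (intro mult_left_mono weighted_arith_geom_mean I a) (auto simp: less_imp_le)
      finally show ?thesis .
    qed
    have hint: "integrable M h" unfolding h_def using int by auto
    have P0: "0 \<le> ?P x" for x by (intro prod_nonneg) auto
    have Pint: "integrable M ?P"
      by (rule Bochner_Integration.integrable_bound[OF hint meas])
         (use le P0 in \<open>auto intro!: AE_I2 intro: order_trans[OF _ abs_ge_self]\<close>)
    have "(\<integral>x. ?P x \<partial>M) \<le> (\<integral>x. h x \<partial>M)" by (rule integral_mono[OF Pint hint le])
    also have "\<dots> = C * (\<Sum>i\<in>I. a i * (c i / c i))"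
      unfolding h_def c_def using int by (auto simp: Bochner_Integration.integral_sum intro!: sum.cong)
    also have "(\<Sum>i\<in>I. a i * (c i / c i)) = 1"
      unfolding a(2)[symmetric] by (intro sum.cong) (auto dest: pos)
    finally show ?thesis using Pint by (simp add: C_def)
  qed
  then show "integrable M ?P" "(\<integral>x. ?P x \<partial>M) \<le> (\<Prod>i\<in>I. (\<integral>x. G i x \<partial>M) powr a i)"
    by (auto simp: c_def)
qed

context padic
begin

section \<open>Masses of a weight\<close>

lemma measure_pballs_pos: "B \<in> pballs p \<Longrightarrow> 0 < measure (haar p) B"
  by (auto elim!: pballs_E simp: measure_pball)

lemma emeasure_pballs_finite: "B \<in> pballs p \<Longrightarrow> emeasure (haar p) B < \<infinity>"
  by (auto elim!: pballs_E simp: emeasure_pball)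

lemma emeasure_pballs: "B \<in> pballs p \<Longrightarrow> emeasure (haar p) B = ennreal (measure (haar p) B)"
  using emeasure_pballs_finite[of B] by (intro emeasure_eq_ennreal_measure) auto

lemma weight_nonneg_AE: "is_weight p w \<Longrightarrow> AE x in haar p. 0 \<le> indicator E x * w x"
  unfolding is_weight_def by (auto elim!: eventually_mono)

lemma set_integrable_weight:
  assumes "is_weight p w" "B \<in> pballs p" "E \<in> sets (haar p)" "E \<subseteq> B"
  shows "set_integrable (haar p) E w"
  using set_integrable_subset[of "haar p" B w E] assms unfolding is_weight_def by blast

lemma wmeas_nonneg: "is_weight p w \<Longrightarrow> 0 \<le> wmeas p w E"
  unfolding wmeas_def set_lebesgue_integral_def
  by (rule integral_nonneg_AE) (use weight_nonneg_AE in simp)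

lemma emeasure_density_weight:
  assumes w: "is_weight p w" and B: "B \<in> pballs p" and E: "E \<in> sets (haar p)" "E \<subseteq> B"
  shows "emeasure (density (haar p) (\<lambda>x. ennreal (w x))) E = ennreal (wmeas p w E)"
proof -
  have [measurable]: "w \<in> borel_measurable (haar p)" using w by (simp add: is_weight_def)
  have "emeasure (density (haar p) (\<lambda>x. ennreal (w x))) E = (\<integral>\<^sup>+ x. ennreal (w x) * indicator E x \<partial>haar p)"
    using E by (subst emeasure_density) auto
  also have "\<dots> = (\<integral>\<^sup>+ x. ennreal (indicator E x * w x) \<partial>haar p)"
    by (intro nn_integral_cong) (auto split: split_indicator)
  also have "\<dots> = ennreal (\<integral> x. indicator E x * w x \<partial>haar p)"
    using set_integrable_weight[OF w B E] weight_nonneg_AE[OF w]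
    by (intro nn_integral_eq_integral) (auto simp: set_integrable_def)
  finally show ?thesis by (simp add: wmeas_def set_lebesgue_integral_def)
qed

lemma wmeas_pos:
  assumes w: "is_weight p w" and B: "B \<in> pballs p"
  shows "0 < wmeas p w B"
proof (rule ccontr)
  have [measurable]: "B \<in> sets (haar p)" using B pballs_sets by blast
  assume "\<not> 0 < wmeas p w B"
  then have "(\<integral> x. indicator B x * w x \<partial>haar p) = 0"
    using wmeas_nonneg[OF w, of B] by (simp add: wmeas_def set_lebesgue_integral_def)
  then have "AE x in haar p. indicator B x * w x = 0"
    using integral_nonneg_eq_0_iff_AE[OF _ weight_nonneg_AE[OF w]] w B
    by (auto simp: is_weight_def set_integrable_def)
  moreover have "AE x in haar p. 0 < w x" using w by (simp add: is_weight_def)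
  ultimately have "AE x in haar p. x \<notin> B" by eventually_elim (auto split: split_indicator)
  then have "emeasure (haar p) B = 0"
    using sets.sets_into_space[of B "haar p"]
    by (subst (asm) AE_iff_null) (auto simp: null_sets_def Collect_conj_eq Int_absorb1)
  then show False using emeasure_pballs[OF B] measure_pballs_pos[OF B] by simp
qed

lemma wmeas_mono:
  assumes w: "is_weight p w" and B: "B \<in> pballs p" and E: "E \<in> sets (haar p)" "F \<in> sets (haar p)" "E \<subseteq> F" "F \<subseteq> B"
  shows "wmeas p w E \<le> wmeas p w F"
proof -
  have "ennreal (wmeas p w E) \<le> ennreal (wmeas p w F)"
    using emeasure_density_weight[OF w B, of E] emeasure_density_weight[OF w B, of F] E
      emeasure_mono[of E F "density (haar p) (\<lambda>x. ennreal (w x))"] by simp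
  then show ?thesis using wmeas_nonneg[OF w] by simp
qed

text \<open>For \<open>\<zeta> > 1\<close> this is Hoelder's inequality for \<open>u\<close> written
  as \<open>u w^(1/\<zeta>)\<close> times \<open>w^(-1/\<zeta>)\<close>, the second factor being
  controlled by \<open>A\<^sub>\<zeta>\<close>; for \<open>\<zeta> = 1\<close> the weight is almost
  everywhere on \<open>B\<close> at least a fixed multiple of its mean. Integrability of
  \<open>u\<close> belongs to the conclusion because the functions to be inserted are known to be
  integrable only against the weight.\<close>

lemma A_weight_avg:
  fixes w :: "('n::finite \<Rightarrow> int \<Rightarrow> nat) \<Rightarrow> real"
  assumes A: "A_weight p \<zeta> w" and z: "1 \<le> \<zeta>"
  obtains K where "1 \<le> K"
    "\<And>B u. B \<in> pballs p \<Longrightarrow> u \<in> borel_measurable (haar p) \<Longrightarrow> (\<And>x. 0 \<le> u x) \<Longrightarrow>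
       set_integrable (haar p) B (\<lambda>x. u x powr \<zeta> * w x) \<Longrightarrow>
       set_integrable (haar p) B u \<and>
       avg p B u powr \<zeta> \<le> K * (LINT x:B|haar p. u x powr \<zeta> * w x) / wmeas p w B"
proof -
  have w: "is_weight p w" using A by (simp add: A_weight_def)
  then have wm [measurable]: "w \<in> borel_measurable (haar p)" and wpos: "AE x in haar p. 0 < w x"
    by (auto simp: is_weight_def)
  have avg_w: "avg p B w = wmeas p w B / measure (haar p) B" for B
    by (simp add: avg_def wmeas_def)
  show ?thesis
  proof (cases "\<zeta> = 1")
    case True
    then obtain C where C: "\<And>B. B \<in> pballs p \<Longrightarrow> AE x in haar p. x \<in> B \<longrightarrow> avg p B w \<le> C * w x"
      using A by (auto simp: A_weight_def)
    show ?thesis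
    proof (rule that[of "max C 1"], simp)
      fix B :: "('n \<Rightarrow> int \<Rightarrow> nat) set" and u :: "('n \<Rightarrow> int \<Rightarrow> nat) \<Rightarrow> real"
      assume B: "B \<in> pballs p" and um [measurable]: "u \<in> borel_measurable (haar p)" and u0: "\<And>x. 0 \<le> u x"
        and int: "set_integrable (haar p) B (\<lambda>x. u x powr \<zeta> * w x)"
      have [measurable]: "B \<in> sets (haar p)" using B pballs_sets by blast
      have a: "0 < avg p B w" unfolding avg_w using wmeas_pos[OF w B] measure_pballs_pos[OF B] by simp
      \<comment> \<open>With this \<open>c\<close> the \<open>A\<^sub>1\<close> condition gives
        \<open>1 \<le> c * w x\<close> almost everywhere on \<open>B\<close>.\<close>
      define c where "c = max C 1 / avg p B w"
      have c: "0 < c" using a by (simp add: c_def)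
      have le: "AE x in haar p. indicator B x * u x \<le> c * (indicator B x * (u x powr \<zeta> * w x))"
        using C[OF B] wpos
      proof eventually_elim
        case (elim x)
        have "1 \<le> c * w x" if "x \<in> B"
        proof -
          have "avg p B w \<le> C * w x" using elim that by simp
          also have "\<dots> \<le> max C 1 * w x" using elim by (intro mult_right_mono) auto
          finally show ?thesis using a by (simp add: c_def field_simps)
        qed
        then have "x \<in> B \<Longrightarrow> u x * 1 \<le> u x * (c * w x)" using u0 by (intro mult_left_mono) auto
        then show ?case using True u0[of x] by (auto split: split_indicator simp: mult_ac)
      qed
      have int': "integrable (haar p) (\<lambda>x. c * (indicator B x * (u x powr \<zeta> * w x)))"
        using int by (auto simp: set_integrable_def)
      have iu: "integrable (haar p) (\<lambda>x. indicator B x * u x)"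
      proof (rule Bochner_Integration.integrable_bound[OF int'])
        show "AE x in haar p. norm (indicator B x * u x) \<le> norm (c * (indicator B x * (u x powr \<zeta> * w x)))"
          using le
        proof eventually_elim
          case (elim x)
          have "0 \<le> indicator B x * u x" using u0 by simp
          then show ?case using elim unfolding real_norm_def by linarith
        qed
      qed simp
      have "(LINT x:B|haar p. u x) \<le> c * (LINT x:B|haar p. u x powr \<zeta> * w x)"
        using integral_mono_AE[OF iu int' le] by (simp add: set_lebesgue_integral_def)
      then have "avg p B u \<le> c * (LINT x:B|haar p. u x powr \<zeta> * w x) / measure (haar p) B"
        unfolding avg_def by (rule divide_right_mono) simp
      also have "\<dots> = max C 1 * (LINT x:B|haar p. u x powr \<zeta> * w x) / wmeas p w B"
        using measure_pballs_pos[OF B] by (simp add: c_def avg_w)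
      finally have "avg p B u \<le> \<dots>" .
      moreover have "0 \<le> avg p B u" unfolding avg_def set_lebesgue_integral_def using u0
        by (auto intro!: divide_nonneg_nonneg integral_nonneg_AE)
      ultimately show "set_integrable (haar p) B u \<and>
          avg p B u powr \<zeta> \<le> max C 1 * (LINT x:B|haar p. u x powr \<zeta> * w x) / wmeas p w B"
        using iu True by (simp add: set_integrable_def)
    qed
  next
    case False
    then have z1: "1 < \<zeta>" using z by simp
    let ?v = "\<lambda>x. w x powr (-1 / (\<zeta> - 1))"
    obtain C where vint: "\<And>B. B \<in> pballs p \<Longrightarrow> set_integrable (haar p) B ?v"
      and C: "\<And>B. B \<in> pballs p \<Longrightarrow> avg p B w * avg p B ?v powr (\<zeta> - 1) \<le> C"
      using A False by (auto simp: A_weight_def)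
    show ?thesis
    proof (rule that[of "max C 1"], simp)
      fix B :: "('n \<Rightarrow> int \<Rightarrow> nat) set" and u :: "('n \<Rightarrow> int \<Rightarrow> nat) \<Rightarrow> real"
      assume B: "B \<in> pballs p" and um [measurable]: "u \<in> borel_measurable (haar p)" and u0: "\<And>x. 0 \<le> u x"
        and int: "set_integrable (haar p) B (\<lambda>x. u x powr \<zeta> * w x)"
      have [measurable]: "B \<in> sets (haar p)" using B pballs_sets by blast
      have a: "0 < avg p B w" unfolding avg_w using wmeas_pos[OF w B] measure_pballs_pos[OF B] by simp
      let ?L = "LINT x:B|haar p. u x powr \<zeta> * w x" and ?V = "LINT x:B|haar p. ?v x"
      \<comment> \<open>The weight is positive only almost everywhere, while the Hoelder inequality
        asks for factors that are nonnegative everywhere; hence the absolute value.\<close>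
      define G where "G b x = (if b then \<bar>indicator B x * (u x powr \<zeta> * w x)\<bar> else indicator B x * ?v x)" for b x
      define e where "e b = (if b then 1 / \<zeta> else 1 - 1 / \<zeta>)" for b
      have Gint: "integrable (haar p) (G b)" for b
        using int vint[OF B] unfolding G_def set_integrable_def by (cases b) auto
      have G0: "0 \<le> G b x" for b x by (simp add: G_def)
      have e: "0 < e b" for b using z1 by (simp add: e_def)
      have e1: "(\<Sum>b\<in>UNIV. e b) = 1" by (simp add: e_def UNIV_bool)
      have eq: "AE x in haar p. (\<Prod>b\<in>UNIV. G b x powr e b) = indicator B x * u x"
        using wpos
      proof eventually_elim
        case (elim x)
        have "(u x powr \<zeta> * w x) powr (1 / \<zeta>) * (?v x) powr (1 - 1 / \<zeta>)
            = u x * (w x powr (1 / \<zeta>) * w x powr (- (1 / \<zeta>)))"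
        proof -
          have "-1 / (\<zeta> - 1) * (1 - 1 / \<zeta>) = - (1 / \<zeta>)" using z1 by (simp add: field_simps)
          then have "(?v x) powr (1 - 1 / \<zeta>) = w x powr (- (1 / \<zeta>))"
            by (simp only: powr_powr)
          moreover have "(u x powr \<zeta> * w x) powr (1 / \<zeta>) = u x * w x powr (1 / \<zeta>)"
            using elim u0[of x] z1 by (simp add: powr_mult powr_powr)
          ultimately show ?thesis by simp
        qed
        also have "\<dots> = u x" using elim by (simp flip: powr_add)
        finally show ?case using elim u0[of x]
          by (auto simp: UNIV_bool G_def e_def abs_mult mult.commute split: split_indicator)
      qed
      note H = Holder_prod[OF finite_class.finite_UNIV e e1 Gint G0]
      have iu: "integrable (haar p) (\<lambda>x. indicator B x * u x)"
        using H(1) integrable_cong_AE[OF _ _ eq] by (auto simp: G_def)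
      have V0: "0 \<le> ?V" unfolding set_lebesgue_integral_def by (rule integral_nonneg_AE) auto
      have U0: "0 \<le> (LINT x:B|haar p. u x)" unfolding set_lebesgue_integral_def
        by (rule integral_nonneg_AE) (use u0 in auto)
      have Lae: "AE x in haar p. \<bar>indicator B x * (u x powr \<zeta> * w x)\<bar> = indicator B x * (u x powr \<zeta> * w x)"
        using wpos by eventually_elim (auto simp: abs_mult)
      have L: "(\<integral>x. G True x \<partial>haar p) = ?L"
        unfolding set_lebesgue_integral_def G_def using integral_cong_AE[OF _ _ Lae] by simp
      have L0: "0 \<le> ?L" unfolding L[symmetric] by (rule integral_nonneg_AE) (use G0 in auto)
      have V: "(\<integral>x. G False x \<partial>haar p) = ?V"
        unfolding set_lebesgue_integral_def G_def by simp
      have "(LINT x:B|haar p. u x) = (\<integral>x. (\<Prod>b\<in>UNIV. G b x powr e b) \<partial>haar p)"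
        unfolding set_lebesgue_integral_def using integral_cong_AE[OF _ _ eq] iu H(1) by auto
      also have "\<dots> \<le> (\<Prod>b\<in>UNIV. (\<integral>x. G b x \<partial>haar p) powr e b)" by (rule H(2))
      also have "\<dots> = ?L powr (1 / \<zeta>) * ?V powr (1 - 1 / \<zeta>)"
        by (simp add: UNIV_bool L V e_def mult.commute)
      finally have "(LINT x:B|haar p. u x) powr \<zeta> \<le> (?L powr (1 / \<zeta>) * ?V powr (1 - 1 / \<zeta>)) powr \<zeta>"
        using U0 z1 by (intro powr_mono2) auto
      also have "\<dots> = ?L * ?V powr (\<zeta> - 1)"
      proof -
        have "(1 - 1 / \<zeta>) * \<zeta> = \<zeta> - 1" using z1 by (simp add: field_simps)
        then show ?thesis using L0 z1 by (simp add: powr_mult powr_powr)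
      qed
      finally have main: "(LINT x:B|haar p. u x) powr \<zeta> \<le> ?L * ?V powr (\<zeta> - 1)" .
      let ?m = "measure (haar p) B"
      have m: "0 < ?m" by (rule measure_pballs_pos[OF B])
      have "avg p B u powr \<zeta> = (LINT x:B|haar p. u x) powr \<zeta> / ?m powr \<zeta>"
        unfolding avg_def using U0 m by (simp add: powr_divide)
      also have "\<dots> \<le> ?L * ?V powr (\<zeta> - 1) / ?m powr \<zeta>"
        using main by (rule divide_right_mono) simp
      also have "\<dots> = ?L / ?m * avg p B ?v powr (\<zeta> - 1)"
      proof -
        have "?m powr \<zeta> = ?m * ?m powr (\<zeta> - 1)" using m powr_add[of ?m 1 "\<zeta> - 1"] by simp
        then show ?thesis unfolding avg_def using V0 m by (simp add: powr_divide)
      qed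
      also have "\<dots> \<le> ?L / ?m * (max C 1 / avg p B w)"
      proof (rule mult_left_mono)
        have "avg p B w * avg p B ?v powr (\<zeta> - 1) \<le> max C 1" using C[OF B] by simp
        then show "avg p B ?v powr (\<zeta> - 1) \<le> max C 1 / avg p B w" using a by (simp add: field_simps)
      qed (use L0 m in simp)
      also have "\<dots> = max C 1 * ?L / wmeas p w B" using m by (simp add: avg_w)
      finally show "set_integrable (haar p) B u \<and>
          avg p B u powr \<zeta> \<le> max C 1 * ?L / wmeas p w B"
        using iu by (simp add: set_integrable_def)
    qed
  qed
qed

text \<open>The averaged inequality tested on the indicator of \<open>E\<close>: a subset with a
  fixed share of the measure carries a fixed share of the mass.\<close>

lemma A_weight_subset:
  fixes w :: "('n::finite \<Rightarrow> int \<Rightarrow> nat) \<Rightarrow> real"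
  assumes A: "A_weight p \<zeta> w" and z: "1 \<le> \<zeta>"
  obtains K where "1 \<le> K"
    "\<And>B E. B \<in> pballs p \<Longrightarrow> E \<in> sets (haar p) \<Longrightarrow> E \<subseteq> B \<Longrightarrow>
       (measure (haar p) E / measure (haar p) B) powr \<zeta> * wmeas p w B \<le> K * wmeas p w E"
proof -
  have w: "is_weight p w" using A by (simp add: A_weight_def)
  obtain K where K: "1 \<le> K" "\<And>B u. B \<in> pballs p \<Longrightarrow> u \<in> borel_measurable (haar p) \<Longrightarrow> (\<And>x. 0 \<le> u x) \<Longrightarrow>
       set_integrable (haar p) B (\<lambda>x. u x powr \<zeta> * w x) \<Longrightarrow>
       set_integrable (haar p) B u \<and>
       avg p B u powr \<zeta> \<le> K * (LINT x:B|haar p. u x powr \<zeta> * w x) / wmeas p w B"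
    using A_weight_avg[OF A z] by blast
  show ?thesis
  proof (rule that[OF K(1)])
    fix B E :: "('n \<Rightarrow> int \<Rightarrow> nat) set"
    assume B: "B \<in> pballs p" and E: "E \<in> sets (haar p)" "E \<subseteq> B"
    let ?u = "indicator E :: _ \<Rightarrow> real"
    have eq: "indicator B x *\<^sub>R (?u x powr \<zeta> * w x) = indicator E x *\<^sub>R w x" for x
      using E z by (auto split: split_indicator)
    have "set_integrable (haar p) B (\<lambda>x. ?u x powr \<zeta> * w x)"
      using set_integrable_weight[OF w B E] unfolding set_integrable_def eq .
    moreover have "(LINT x:B|haar p. ?u x powr \<zeta> * w x) = wmeas p w E"
      unfolding set_lebesgue_integral_def wmeas_def eq ..
    moreover have "(LINT x:B|haar p. ?u x) = measure (haar p) E"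
    proof -
      have eq: "indicator B x *\<^sub>R ?u x = ?u x" for x using E by (auto split: split_indicator)
      show ?thesis unfolding set_lebesgue_integral_def eq using sets.sets_into_space[OF E(1)]
        by (simp add: Int_absorb2)
    qed
    ultimately have "(measure (haar p) E / measure (haar p) B) powr \<zeta> \<le> K * wmeas p w E / wmeas p w B"
      using K(2)[OF B, of ?u] E by (simp add: avg_def)
    then show "(measure (haar p) E / measure (haar p) B) powr \<zeta> * wmeas p w B \<le> K * wmeas p w E"
      using wmeas_pos[OF w B] by (simp add: field_simps)
  qed
qed

end

subsection \<open>The reverse Hoelder inequality\<close>

locale padic_weight = padic +
  fixes w :: "('n::finite \<Rightarrow> int \<Rightarrow> nat) \<Rightarrow> real"
  assumes weight: "is_weight p w"
begin

abbreviation W :: "('n \<Rightarrow> int \<Rightarrow> nat) measure" where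
  "W \<equiv> density (haar p) (\<lambda>x. ennreal (w x))"

lemma w_measurable [measurable]: "w \<in> borel_measurable (haar p)"
  and w_pos: "AE x in haar p. 0 < w x"
  using weight by (auto simp: is_weight_def)

lemma emeasure_W: "B \<in> pballs p \<Longrightarrow> E \<in> sets (haar p) \<Longrightarrow> E \<subseteq> B \<Longrightarrow> emeasure W E = ennreal (wmeas p w E)"
  by (rule emeasure_density_weight[OF weight])

text \<open>This replaces the Lebesgue differentiation theorem: a set \<open>E\<close> of points with \<open>w > c\<close> is
  covered, up to small measure, by equal balls on each of which the mean of \<open>w\<close> is at most \<open>c\<close>,
  so that the integral of \<open>w\<close> over \<open>E\<close> is at most \<open>c\<close> times the measure of \<open>E\<close>.\<close>

lemma AE_le_if_means_le:
  assumes a: "a \<in> Qpn p" and F: "F \<in> sets (haar p)" "F \<subseteq> pball p G a" and c: "0 \<le> c"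
    and le: "\<And>x g. x \<in> F \<Longrightarrow> g \<le> G \<Longrightarrow> wmeas p w (pball p g x) \<le> c * measure (haar p) (pball p g x)"
  shows "AE x in haar p. x \<in> F \<longrightarrow> w x \<le> c"
proof -
  define B where "B = pball p G a"
  have B: "B \<in> pballs p" using a by (simp add: B_def)
  then have [measurable]: "B \<in> sets (haar p)" by (rule pballs_sets)
  define E where "E = {x \<in> space (haar p). x \<in> F \<and> c < w x}"
  have E [measurable]: "E \<in> sets (haar p)" unfolding E_def using F by measurable
  have EF: "E \<subseteq> F" and EB: "E \<subseteq> B" using F by (auto simp: E_def B_def)
  \<comment> \<open>One finite measure dominating both Haar measure and the weighted measure on
    \<open>B\<close>, so that a single set \<open>D\<close> approximates \<open>E\<close> for
    both.\<close>
  define M where "M = density (haar p) (\<lambda>x. (1 + ennreal (w x)) * indicator B x)"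
  have emM: "emeasure M X = emeasure (haar p) (X \<inter> B) + emeasure W (X \<inter> B)" if [measurable]: "X \<in> sets (haar p)" for X
  proof -
    have "emeasure M X = (\<integral>\<^sup>+ x. indicator (X \<inter> B) x + ennreal (w x) * indicator (X \<inter> B) x \<partial>haar p)"
      unfolding M_def by (subst emeasure_density)
        (auto intro!: nn_integral_cong split: split_indicator)
    also have "\<dots> = emeasure (haar p) (X \<inter> B) + emeasure W (X \<inter> B)"
      by (subst nn_integral_add) (auto simp: emeasure_density)
    finally show ?thesis .
  qed
  have "emeasure M (space M) = emeasure (haar p) B + emeasure W B"
    using emM[of "Qpn p"] sets.top[of "haar p"] sets.sets_into_space[of B "haar p"] B
    by (auto simp: M_def Int_absorb1)
  also have "\<dots> \<noteq> \<infinity>" using emeasure_pballs[OF B] emeasure_W[OF B, of B] by simp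
  finally have finM: "finite_measure M" by (rule finite_measureI)
  have "emeasure W E \<le> ennreal c * emeasure (haar p) E"
  proof (rule ennreal_le_epsilon)
    fix e :: real assume e: "0 < e"
    \<comment> \<open>Two errors arise: \<open>c * \<eta>\<close> from the excess of the balls over
      \<open>E\<close>, and \<open>\<eta>\<close> from the part of \<open>E\<close> outside
      \<open>D\<close>.\<close>
    define \<eta> where "\<eta> = e / (c + 1)"
    have \<eta>: "0 < \<eta>" using e c by (simp add: \<eta>_def)
    obtain g D where D: "level g D" "measure M ((E - D) \<union> (D - E)) \<le> \<eta>"
      using approx_by_level_sets[OF finM _ E \<eta>] by (auto simp: M_def)
    define g' where "g' = min g G"
    have D': "level g' D" using level_mono[OF D(1)] by (simp add: g'_def)
    have Dm [measurable]: "D \<in> sets (haar p)" by (rule level_sets[OF D(1)])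
    have emD: "emeasure M ((E - D) \<union> (D - E)) \<le> ennreal \<eta>"
      using D(2) finite_measure.emeasure_eq_measure[OF finM] by (simp add: ennreal_leI)
    define Q where "Q = (\<lambda>x. pball p g' x) ` (E \<inter> D)"
    have EQ: "E \<subseteq> Qpn p" by (auto simp: E_def)
    have Qb: "Q \<subseteq> pballs p" using EQ by (auto simp: Q_def)
    have Qd: "disjoint Q"
    proof (rule disjointI)
      fix R S assume RS: "R \<in> Q" "S \<in> Q" "R \<noteq> S"
      then obtain x y where "R = pball p g' x" "S = pball p g' y" by (auto simp: Q_def)
      then show "R \<inter> S = {}" using RS(3) pball_eqI by blast
    qed
    have QD: "\<Union>Q \<subseteq> D \<inter> B"
    proof -
      have "pball p g' x \<subseteq> D" "pball p g' x \<subseteq> B" if "x \<in> E \<inter> D" for x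
        using that D' EB pball_subset[of x G a g'] by (auto simp: level_def B_def g'_def)
      then show ?thesis by (auto simp: Q_def)
    qed
    have Qm [measurable]: "\<Union>Q \<in> sets (haar p)"
      using Qb countable_subset[OF Qb countable_pballs] pballs_sets by (intro sets.countable_Union) auto
    have ED: "E \<inter> D \<subseteq> \<Union>Q" using EQ pball_self unfolding Q_def by blast
    have "emeasure W E \<le> emeasure W (\<Union>Q \<union> (E - D))"
      using ED by (intro emeasure_mono) auto
    also have "\<dots> \<le> emeasure W (\<Union>Q) + emeasure W (E - D)"
      by (intro emeasure_subadditive) auto
    also have "emeasure W (\<Union>Q) = emeasure W (Qpn p \<inter> \<Union>Q)"
      using Qb pballs_Pow by (intro arg_cong[where f = "emeasure W"]) blast
    also have "\<dots> \<le> ennreal c * emeasure (haar p) (Qpn p \<inter> \<Union>Q)"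
    proof (rule emeasure_le_on_balls[OF Qb Qd])
      fix b assume b: "b \<in> Q"
      then obtain x where x: "x \<in> E \<inter> D" "b = pball p g' x" by (auto simp: Q_def)
      have bp: "b \<in> pballs p" using b Qb by blast
      have "Qpn p \<inter> b = b" using bp pballs_Pow by blast
      moreover have "wmeas p w b \<le> c * measure (haar p) b"
        unfolding x(2) using x EF by (intro le) (auto simp: g'_def)
      ultimately show "emeasure W (Qpn p \<inter> b) \<le> ennreal c * emeasure (haar p) (Qpn p \<inter> b)"
        using emeasure_W[OF bp pballs_sets[OF bp] order_refl] emeasure_pballs[OF bp] c
        by (simp add: ennreal_leI flip: ennreal_mult)
    qed (use sets.top[of "haar p"] in auto)
    also have "Qpn p \<inter> \<Union>Q = \<Union>Q" using Qb pballs_Pow by blast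
    also have "emeasure (haar p) (\<Union>Q) \<le> emeasure (haar p) (E \<union> ((D - E) \<inter> B))"
      using QD by (intro emeasure_mono) auto
    also have "\<dots> \<le> emeasure (haar p) E + emeasure (haar p) ((D - E) \<inter> B)"
      by (intro emeasure_subadditive) auto
    also have "emeasure (haar p) ((D - E) \<inter> B) \<le> ennreal \<eta>"
    proof -
      have "emeasure (haar p) ((D - E) \<inter> B) \<le> emeasure M (D - E)" by (subst emM) auto
      also have "\<dots> \<le> emeasure M ((E - D) \<union> (D - E))"
        by (intro emeasure_mono) (auto simp: M_def)
      finally show ?thesis using emD by simp
    qed
    also have "emeasure W (E - D) \<le> ennreal \<eta>"
    proof -
      have "(E - D) \<inter> B = E - D" using EB by blast
      then have "emeasure W (E - D) \<le> emeasure M (E - D)" by (subst emM) auto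
      also have "\<dots> \<le> emeasure M ((E - D) \<union> (D - E))"
        by (intro emeasure_mono) (auto simp: M_def)
      finally show ?thesis using emD by simp
    qed
    finally have "emeasure W E \<le> ennreal c * (emeasure (haar p) E + ennreal \<eta>) + ennreal \<eta>"
      by (simp add: add_mono mult_left_mono)
    also have "\<dots> = ennreal c * emeasure (haar p) E + (ennreal c * ennreal \<eta> + ennreal \<eta>)"
      by (simp add: distrib_left add.assoc)
    also have "ennreal c * ennreal \<eta> + ennreal \<eta> = ennreal e"
    proof -
      have "c * \<eta> + \<eta> = (c + 1) * \<eta>" by (simp add: algebra_simps)
      then have "c * \<eta> + \<eta> = e" using c by (simp add: \<eta>_def)
      then show ?thesis using c \<eta> by (simp flip: ennreal_mult ennreal_plus)
    qed
    finally show "emeasure W E \<le> ennreal c * emeasure (haar p) E + ennreal e" .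
  qed
  moreover have fE: "emeasure (haar p) E < \<infinity>"
    using emeasure_mono[OF EB, of "haar p"] emeasure_pballs_finite[OF B] by (simp add: order_le_less_trans)
  ultimately have wE: "wmeas p w E \<le> c * measure (haar p) E"
    using emeasure_W[OF B E EB] c by (simp add: emeasure_eq_ennreal_measure flip: ennreal_mult)
  have i1: "integrable (haar p) (\<lambda>x. indicator E x * w x)"
    using set_integrable_weight[OF weight B E EB] by (simp add: set_integrable_def)
  have i2: "integrable (haar p) (\<lambda>x. indicator E x * c)"
    using fE sets.sets_into_space[OF E]
    by (intro integrable_mult_left) (auto simp: integrable_indicator_iff less_top Int_absorb2)
  have diff: "indicator E x * (w x - c) = indicator E x * w x - indicator E x * c" for x
    by (simp add: algebra_simps)
  have int: "integrable (haar p) (\<lambda>x. indicator E x * (w x - c))"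
    unfolding diff using i1 i2 by simp
  have nn: "0 \<le> indicator E x * (w x - c)" for x by (auto simp: E_def split: split_indicator)
  have "(\<integral>x. indicator E x * (w x - c) \<partial>haar p) = wmeas p w E - c * measure (haar p) E"
    unfolding diff using i1 i2 sets.sets_into_space[OF E]
    by (simp add: wmeas_def set_lebesgue_integral_def Int_absorb2)
  moreover have "0 \<le> (\<integral>x. indicator E x * (w x - c) \<partial>haar p)"
    by (rule integral_nonneg_AE) (use nn in auto)
  \<comment> \<open>The integrand is strictly positive on \<open>E\<close>, so a zero integral
    forces \<open>E\<close> to be a null set.\<close>
  ultimately have "(\<integral>x. indicator E x * (w x - c) \<partial>haar p) = 0" using wE by linarith
  then have "AE x in haar p. indicator E x * (w x - c) = 0"
    using integral_nonneg_eq_0_iff_AE[OF int] nn by auto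
  then show ?thesis
    using AE_space by eventually_elim (auto simp: E_def split: split_indicator_asm)
qed

section \<open>Calderon-Zygmund stopping balls\<close>

definition heavy :: "real \<Rightarrow> int \<Rightarrow> ('n \<Rightarrow> int \<Rightarrow> nat) \<Rightarrow> bool" where
  "heavy l g x \<longleftrightarrow> l * measure (haar p) (pball p g x) < wmeas p w (pball p g x)"

text \<open>The Calderon-Zygmund balls of \<open>w\<close> at height \<open>l\<close> relative to
  \<open>pball p G a\<close>. Radii above \<open>p^G\<close> are left aside, so that a largest heavy
  ball exists about each point that has one.\<close>

definition stopping_balls :: "int \<Rightarrow> ('n \<Rightarrow> int \<Rightarrow> nat) \<Rightarrow> real \<Rightarrow> ('n \<Rightarrow> int \<Rightarrow> nat) set set" where
  "stopping_balls G a l = {pball p g x | g x. x \<in> pball p G a \<and> g \<le> G \<and> heavy l g x \<and>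
     (\<forall>h. g < h \<longrightarrow> h \<le> G \<longrightarrow> \<not> heavy l h x)}"

text \<open>The superlevel set at height \<open>l\<close> of the local maximal function, which takes
  means over balls of radius at most \<open>p^G\<close>.\<close>

definition heavy_set :: "int \<Rightarrow> ('n \<Rightarrow> int \<Rightarrow> nat) \<Rightarrow> real \<Rightarrow> ('n \<Rightarrow> int \<Rightarrow> nat) set" where
  "heavy_set G a l = {x \<in> pball p G a. \<exists>g\<le>G. heavy l g x}"

lemma heavy_cong: "y \<in> pball p g x \<Longrightarrow> g \<le> h \<Longrightarrow> heavy l h y \<longleftrightarrow> heavy l h x"
  using pball_eqI[of y h x] pball_mono[of g h x] by (auto simp: heavy_def)

text \<open>A stopping ball may be recentred at any of its points, since heaviness at its own and at
  larger radii is the same for all of them. Comparing two stopping balls that meet then amounts to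
  comparing two radii about one point.\<close>

lemma stopping_balls_point:
  assumes "Q \<in> stopping_balls G a l" "z \<in> Q"
  obtains g where "z \<in> pball p G a" "g \<le> G" "Q = pball p g z" "heavy l g z"
    "\<And>h. g < h \<Longrightarrow> h \<le> G \<Longrightarrow> \<not> heavy l h z"
proof -
  obtain g x where Q: "Q = pball p g x" "x \<in> pball p G a" "g \<le> G" "heavy l g x"
    "\<And>h. g < h \<Longrightarrow> h \<le> G \<Longrightarrow> \<not> heavy l h x"
    using assms(1) unfolding stopping_balls_def by blast
  have z: "z \<in> pball p g x" using assms(2) Q(1) by simp
  show ?thesis
  proof (rule that[of g])
    show "z \<in> pball p G a" using z pball_subset[OF Q(2,3)] by blast
    show "Q = pball p g z" using Q(1) pball_eqI[OF z] by simp
    show "heavy l g z" using heavy_cong[OF z] Q(4) by simp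
    show "\<not> heavy l h z" if "g < h" "h \<le> G" for h
      using heavy_cong[OF z, of h] Q(5)[OF that] that by simp
  qed (rule Q)
qed

lemma stopping_balls_pballs: "stopping_balls G a l \<subseteq> pballs p"
  using pball_subset_Qpn by (fastforce simp: stopping_balls_def)

lemma disjoint_stopping_balls: "disjoint (stopping_balls G a l)"
proof (rule disjointI)
  fix Q R assume QR: "Q \<in> stopping_balls G a l" "R \<in> stopping_balls G a l" "Q \<noteq> R"
  show "Q \<inter> R = {}"
  proof (rule ccontr)
    assume "Q \<inter> R \<noteq> {}"
    then obtain z where z: "z \<in> Q" "z \<in> R" by blast
    obtain g where g: "g \<le> G" "Q = pball p g z" "heavy l g z" "\<And>h. g < h \<Longrightarrow> h \<le> G \<Longrightarrow> \<not> heavy l h z"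
      using stopping_balls_point[OF QR(1) z(1)] by metis
    obtain k where k: "k \<le> G" "R = pball p k z" "heavy l k z" "\<And>h. k < h \<Longrightarrow> h \<le> G \<Longrightarrow> \<not> heavy l h z"
      using stopping_balls_point[OF QR(2) z(2)] by metis
    have "g = k" using g k by (metis linorder_neqE)
    then show False using QR(3) g k by simp
  qed
qed

lemma Union_stopping_balls: "\<Union>(stopping_balls G a l) = heavy_set G a l"
proof (intro equalityI subsetI)
  fix z assume "z \<in> \<Union>(stopping_balls G a l)"
  then show "z \<in> heavy_set G a l"
    unfolding heavy_set_def using stopping_balls_point by (metis (mono_tags, lifting) UnionE mem_Collect_eq)
next
  fix x assume "x \<in> heavy_set G a l"
  then obtain g where x: "x \<in> pball p G a" and g: "g \<le> G" "heavy l g x" by (auto simp: heavy_set_def)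
  \<comment> \<open>Only finitely many radii lie between \<open>p^g\<close> and \<open>p^G\<close>,
    so there is a largest heavy one.\<close>
  define H where "H = {h \<in> {g..G}. heavy l h x}"
  have "finite H" unfolding H_def by (rule finite_subset[of _ "{g..G}"]) auto
  moreover have "H \<noteq> {}" using g by (auto simp: H_def)
  ultimately have H: "finite H" "H \<noteq> {}" .
  define k where "k = Max H"
  have k: "k \<in> H" unfolding k_def using H by simp
  have "\<not> heavy l h x" if "k < h" "h \<le> G" for h
  proof
    assume "heavy l h x"
    then have "h \<in> H" using that k by (auto simp: H_def)
    then show False using Max_ge[OF H(1)] that k_def by fastforce
  qed
  then have "pball p k x \<in> stopping_balls G a l"
    using x k unfolding stopping_balls_def H_def by auto
  moreover have "x \<in> pball p k x" using x pball_subset_Qpn by (intro pball_self) blast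
  ultimately show "x \<in> \<Union>(stopping_balls G a l)" by blast
qed

lemma sets_heavy_set [measurable]: "heavy_set G a l \<in> sets (haar p)"
  unfolding Union_stopping_balls[symmetric]
  using countable_subset[OF stopping_balls_pballs countable_pballs] stopping_balls_pballs pballs_sets
  by (intro sets.countable_Union) blast+

lemma heavy_set_subset: "heavy_set G a l \<subseteq> pball p G a"
  by (auto simp: heavy_set_def)

lemma heavy_antimono: "l \<le> l' \<Longrightarrow> heavy l' g x \<Longrightarrow> heavy l g x"
  using mult_right_mono[of l l' "measure (haar p) (pball p g x)"] by (simp add: heavy_def)

text \<open>By maximality the ball of radius \<open>p^(g + 1)\<close> about the same point is not
  heavy, and its measure is \<open>p^n\<close> times that of \<open>Q\<close>. As the whole ball is
  not heavy, \<open>Q\<close> is smaller than it, so this parent is still among the admissible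
  balls.\<close>

lemma stopping_balls_le:
  assumes Q: "Q \<in> stopping_balls G a l" and top: "\<not> heavy l G a" and l: "0 \<le> l"
  shows "wmeas p w Q \<le> real p ^ CARD('n) * l * measure (haar p) Q"
proof -
  obtain g x where Q: "Q = pball p g x" and x: "x \<in> pball p G a" and g: "g \<le> G" "heavy l g x"
    "\<And>h. g < h \<Longrightarrow> h \<le> G \<Longrightarrow> \<not> heavy l h x"
    using Q unfolding stopping_balls_def by blast
  have xQ: "x \<in> Qpn p" using x pball_subset_Qpn by blast
  have "g \<noteq> G" using top heavy_cong[OF x, of G l] g by auto
  then have "\<not> heavy l (g + 1) x" using g by simp
  then have "wmeas p w (pball p (g + 1) x) \<le> l * measure (haar p) (pball p (g + 1) x)"
    by (simp add: heavy_def)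
  moreover have "wmeas p w (pball p g x) \<le> wmeas p w (pball p (g + 1) x)"
    using xQ by (intro wmeas_mono[OF weight pballI[of x "g + 1"]]) (auto simp: pball_mono)
  moreover have "measure (haar p) (pball p (g + 1) x) = real p ^ CARD('n) * measure (haar p) (pball p g x)"
    unfolding measure_pball[OF xQ] by (simp add: distrib_left powr_add powr_realpow mult.commute)
  ultimately show ?thesis unfolding Q by (simp add: mult_ac)
qed

text \<open>A ball that is heavy at the greater height is heavy at the smaller one, so a stopping
  ball for \<open>l'\<close> that meets \<open>Q\<close> cannot be larger than
  \<open>Q\<close>.\<close>

lemma heavy_set_Int_stopping_ball:
  assumes l: "l \<le> l'" and Q: "Q \<in> stopping_balls G a l"
  shows "heavy_set G a l' \<inter> Q = \<Union>{R \<in> stopping_balls G a l'. R \<subseteq> Q}"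
proof (intro equalityI subsetI)
  fix z assume "z \<in> heavy_set G a l' \<inter> Q"
  then obtain R where R: "R \<in> stopping_balls G a l'" "z \<in> R" and z: "z \<in> Q"
    by (auto simp flip: Union_stopping_balls)
  obtain g where g: "g \<le> G" "Q = pball p g z" "\<And>h. g < h \<Longrightarrow> h \<le> G \<Longrightarrow> \<not> heavy l h z"
    using stopping_balls_point[OF Q z] by metis
  obtain k where k: "k \<le> G" "R = pball p k z" "heavy l' k z"
    using stopping_balls_point[OF R] by metis
  have "\<not> g < k" using g(3)[of k] k heavy_antimono[OF l] by blast
  then have "R \<subseteq> Q" using g(2) k(2) pball_mono[of k g z] by simp
  then show "z \<in> \<Union>{R \<in> stopping_balls G a l'. R \<subseteq> Q}" using R by blast
qed (auto simp flip: Union_stopping_balls)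

text \<open>Inside \<open>Q\<close> the stopping balls for \<open>l'\<close> have total measure at
  most \<open>w(Q) / l'\<close>, and \<open>w(Q)\<close> is at most \<open>p^n l |Q|\<close>. The
  factor \<open>2 p^n\<close> between the heights is chosen to leave half of \<open>Q\<close>
  uncovered.\<close>

lemma measure_heavy_set_Int:
  assumes l: "0 < l" "\<not> heavy l G a" and l': "2 * real p ^ CARD('n) * l \<le> l'"
    and Q: "Q \<in> stopping_balls G a l"
  shows "measure (haar p) (heavy_set G a l' \<inter> Q) \<le> measure (haar p) Q / 2"
proof -
  have "1 \<le> real p ^ CARD('n)" by (rule one_le_power) simp
  then have "1 * l \<le> 2 * real p ^ CARD('n) * l" using l \<open>1 \<le> real p ^ CARD('n)\<close> by (intro mult_right_mono) linarith+
  then have ll: "l \<le> l'" using l' by simp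
  then have l'0: "0 < l'" using l by simp
  have Qp: "Q \<in> pballs p" using Q stopping_balls_pballs by blast
  let ?R = "{R \<in> stopping_balls G a l'. R \<subseteq> Q}"
  have R: "?R \<subseteq> pballs p" "disjoint ?R"
    using stopping_balls_pballs disjoint_stopping_balls[of G a l'] by (auto simp: disjoint_def)
  have U: "\<Union>?R = heavy_set G a l' \<inter> Q" using heavy_set_Int_stopping_ball[OF ll Q] by simp
  have UQ: "Qpn p \<inter> \<Union>?R = \<Union>?R" using R(1) pballs_Pow by blast
  have "emeasure (haar p) (Qpn p \<inter> \<Union>?R) \<le> ennreal (1 / l') * emeasure W (Qpn p \<inter> \<Union>?R)"
  proof (rule emeasure_le_on_balls[OF R])
    fix B assume B: "B \<in> ?R"
    then have Bp: "B \<in> pballs p" using R by blast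
    obtain g x where "B = pball p g x" "heavy l' g x" using B by (auto simp: stopping_balls_def)
    then have "l' * measure (haar p) B \<le> wmeas p w B" by (simp add: heavy_def)
    then have "measure (haar p) B \<le> 1 / l' * wmeas p w B" using l'0 by (simp add: field_simps)
    moreover have "Qpn p \<inter> B = B" using Bp pballs_Pow by blast
    ultimately show "emeasure (haar p) (Qpn p \<inter> B) \<le> ennreal (1 / l') * emeasure W (Qpn p \<inter> B)"
      using emeasure_W[OF Bp pballs_sets[OF Bp] order_refl] emeasure_pballs[OF Bp] l'0 wmeas_nonneg[OF weight, of B]
      by (simp add: ennreal_leI flip: ennreal_mult')
  qed (use sets.top[of "haar p"] in auto)
  then have "emeasure (haar p) (\<Union>?R) \<le> ennreal (1 / l') * emeasure W (\<Union>?R)" by (simp only: UQ)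
  also have "\<dots> \<le> ennreal (1 / l') * emeasure W Q"
    unfolding U using pballs_sets[OF Qp] by (intro mult_left_mono emeasure_mono) auto
  also have "\<dots> = ennreal (1 / l' * wmeas p w Q)"
    using emeasure_W[OF Qp pballs_sets[OF Qp] order_refl] l'0 by (simp flip: ennreal_mult')
  also have "\<dots> \<le> ennreal (measure (haar p) Q / 2)"
  proof (rule ennreal_leI)
    have "2 * wmeas p w Q \<le> 2 * real p ^ CARD('n) * l * measure (haar p) Q"
      using stopping_balls_le[OF Q l(2)] l(1) by simp
    also have "\<dots> \<le> l' * measure (haar p) Q" using l' by (intro mult_right_mono) auto
    finally show "1 / l' * wmeas p w Q \<le> measure (haar p) Q / 2" using l'0 by (simp add: field_simps)
  qed
  finally have "emeasure (haar p) (heavy_set G a l' \<inter> Q) \<le> ennreal (measure (haar p) Q / 2)" unfolding U .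
  then show ?thesis
    unfolding measure_def[of _ "heavy_set G a l' \<inter> Q"] by (intro enn2real_leI) auto
qed

text \<open>Raising the height by the factor \<open>b = 2 p^n\<close> leaves at most half of the
  measure of each stopping ball, so by the \<open>A\<^sub>\<zeta>\<close> comparison the mass drops
  by a fixed factor \<open>\<beta> < 1\<close>. Masses decay geometrically while heights grow like
  \<open>b^k\<close>, so a small power \<open>w^\<epsilon>\<close> is integrable against the weight,
  with constants that do not depend on the ball.\<close>

lemma RH_of_A_weight:
  assumes A: "A_weight p \<zeta> w" and z: "1 \<le> \<zeta>"
  shows "\<exists>r>1. RH p r w"
proof -
  obtain K where K: "1 \<le> K" "\<And>B E. B \<in> pballs p \<Longrightarrow> E \<in> sets (haar p) \<Longrightarrow> E \<subseteq> B \<Longrightarrow>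
       (measure (haar p) E / measure (haar p) B) powr \<zeta> * wmeas p w B \<le> K * wmeas p w E"
    using A_weight_subset[OF A z] by metis
  \<comment> \<open>At least half of a stopping ball is left out of the next set, and by
    \<open>A\<^sub>\<zeta>\<close> this part carries at least the share
    \<open>(1 / 2) powr \<zeta> / K\<close> of the mass.\<close>
  define \<beta> where "\<beta> = 1 - (1 / 2) powr \<zeta> / K"
  have "(1 / 2) powr \<zeta> / K \<le> (1 / 2) powr 1 / 1"
    using K(1) z by (intro frac_le powr_mono') auto
  moreover have "0 < (1 / 2) powr \<zeta> / K" using K(1) by simp
  moreover have "(1 / 2 :: real) powr 1 / 1 = 1 / 2" by simp
  ultimately have \<beta>: "0 < \<beta>" "\<beta> < 1" unfolding \<beta>_def by linarith+
  define b where "b = 2 * real p ^ CARD('n)"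
  have "1 \<le> real p ^ CARD('n)" by (rule one_le_power) simp
  then have b: "1 < b" unfolding b_def by linarith
  \<comment> \<open>Chosen so that \<open>b powr \<epsilon> = \<beta> powr (- 1 / 2)\<close>; the
    ratio \<open>\<rho>\<close> of the series below is then the square root of
    \<open>\<beta>\<close>.\<close>
  define \<epsilon> where "\<epsilon> = - ln \<beta> / (2 * ln b)"
  have \<epsilon>: "0 < \<epsilon>" using \<beta> b by (simp add: \<epsilon>_def field_simps)
  define \<rho> where "\<rho> = b powr \<epsilon> * \<beta>"
  have "\<rho> = exp (ln \<beta> / 2)"
  proof -
    have "b powr \<epsilon> = exp (- ln \<beta> / 2)" using b by (simp add: powr_def \<epsilon>_def)
    then have "\<rho> = exp (- ln \<beta> / 2) * exp (ln \<beta>)" using \<beta> by (simp add: \<rho>_def)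
    then show ?thesis by (simp flip: exp_add)
  qed
  then have \<rho>: "0 < \<rho>" "\<rho> < 1" using \<beta> by auto
  \<comment> \<open>The \<open>1\<close> accounts for the points where \<open>w\<close> is at most
    its mean, the fraction for the geometric series over the sets \<open>D k\<close>.\<close>
  define S where "S = 1 + b powr \<epsilon> / (1 - \<rho>)"
  have S: "0 < S" using \<rho> by (simp add: S_def add_pos_nonneg)

  have main: "set_integrable (haar p) B (\<lambda>x. w x powr (1 + \<epsilon>)) \<and>
      avg p B (\<lambda>x. w x powr (1 + \<epsilon>)) \<le> S * avg p B w powr (1 + \<epsilon>)" if B: "B \<in> pballs p" for B
  proof -
    obtain G a where a: "a \<in> Qpn p" "B = pball p G a" using B by (rule pballs_E)
    have [measurable]: "B \<in> sets (haar p)" using B by (rule pballs_sets)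
    have mB: "0 < measure (haar p) B" by (rule measure_pballs_pos[OF B])
    \<comment> \<open>Starting from the mean of \<open>w\<close> ensures that the whole ball is not
      heavy at any of the heights, as the passage to parents requires.\<close>
    define l0 where "l0 = avg p B w"
    have wB: "wmeas p w B = l0 * measure (haar p) B" using mB by (simp add: l0_def avg_def wmeas_def)
    have l0: "0 < l0" using wB wmeas_pos[OF weight B] mB by (simp add: zero_less_mult_iff)
    define l where "l k = b ^ k * l0" for k :: nat
    have l_pos: "0 < l k" for k using b l0 by (simp add: l_def)
    have l_ge: "l0 \<le> l k" for k using b l0 one_le_power[of b k] by (simp add: l_def)
    have l_Suc: "2 * real p ^ CARD('n) * l k = l (Suc k)" for k by (simp add: l_def b_def)
    have l_mono: "l k \<le> l (Suc k)" for k using b l0 by (simp add: l_def)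
    have top: "\<not> heavy (l k) G a" for k
      using l_ge[of k] mB wB a(2) mult_right_mono[OF l_ge[of k], of "measure (haar p) B"] by (simp add: heavy_def)
    define D where "D k = heavy_set G a (l k)" for k
    have D [measurable]: "D k \<in> sets (haar p)" for k by (simp add: D_def)
    have DB: "D k \<subseteq> B" for k using heavy_set_subset a by (simp add: D_def)
    have step: "emeasure W (D (Suc k)) \<le> ennreal \<beta> * emeasure W (D k)" for k
    proof -
      have sub: "D (Suc k) \<subseteq> D k"
        unfolding D_def heavy_set_def using heavy_antimono[OF l_mono] by blast
      have UD: "\<Union>(stopping_balls G a (l k)) = D k" by (simp add: D_def Union_stopping_balls)
      have "emeasure W (D (Suc k) \<inter> \<Union>(stopping_balls G a (l k)))
          \<le> ennreal \<beta> * emeasure W (Qpn p \<inter> \<Union>(stopping_balls G a (l k)))"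
      proof (rule emeasure_le_on_balls[OF stopping_balls_pballs disjoint_stopping_balls])
        fix Q assume Q: "Q \<in> stopping_balls G a (l k)"
        have Qp: "Q \<in> pballs p" using Q stopping_balls_pballs by blast
        have Qs [measurable]: "Q \<in> sets (haar p)" by (rule pballs_sets[OF Qp])
        have mQ: "0 < measure (haar p) Q" by (rule measure_pballs_pos[OF Qp])
        have half: "measure (haar p) (D (Suc k) \<inter> Q) \<le> measure (haar p) Q / 2"
          unfolding D_def using measure_heavy_set_Int[OF l_pos top _ Q] l_Suc by simp
        have "measure (haar p) (Q - D (Suc k)) = measure (haar p) Q - measure (haar p) (D (Suc k) \<inter> Q)"
        proof -
          have "Q - D (Suc k) = Q - D (Suc k) \<inter> Q" by blast
          then show ?thesis using emeasure_pballs_finite[OF Qp]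
            by (simp add: measure_Diff less_top[symmetric])
        qed
        then have "1 / 2 \<le> measure (haar p) (Q - D (Suc k)) / measure (haar p) Q"
          using half mQ by (simp add: field_simps)
        then have "(1 / 2) powr \<zeta> * wmeas p w Q
            \<le> (measure (haar p) (Q - D (Suc k)) / measure (haar p) Q) powr \<zeta> * wmeas p w Q"
          using z wmeas_nonneg[OF weight, of Q] by (intro mult_right_mono powr_mono2) auto
        also have "\<dots> \<le> K * wmeas p w (Q - D (Suc k))" using Qp by (intro K(2)) auto
        finally have 1: "(1 / 2) powr \<zeta> / K * wmeas p w Q \<le> wmeas p w (Q - D (Suc k))"
          using K(1) by (simp add: field_simps)
        have "emeasure W Q = emeasure W (Q - D (Suc k)) + emeasure W (D (Suc k) \<inter> Q)"
          by (subst plus_emeasure) (auto intro!: arg_cong[where f = "emeasure W"])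
        then have "wmeas p w Q = wmeas p w (Q - D (Suc k)) + wmeas p w (D (Suc k) \<inter> Q)"
          using emeasure_W[OF Qp, of Q] emeasure_W[OF Qp, of "Q - D (Suc k)"] emeasure_W[OF Qp, of "D (Suc k) \<inter> Q"]
            wmeas_nonneg[OF weight]
          by (simp flip: ennreal_plus)
        then have "wmeas p w (D (Suc k) \<inter> Q) \<le> \<beta> * wmeas p w Q"
          using 1 by (simp add: \<beta>_def algebra_simps)
        moreover have "Qpn p \<inter> Q = Q" using Qp pballs_Pow by blast
        ultimately show "emeasure W (D (Suc k) \<inter> Q) \<le> ennreal \<beta> * emeasure W (Qpn p \<inter> Q)"
          using emeasure_W[OF Qp, of Q] emeasure_W[OF Qp, of "D (Suc k) \<inter> Q"] \<beta>
          by (simp add: ennreal_leI flip: ennreal_mult')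
      qed (use sets.top[of "haar p"] in auto)
      moreover have "D (Suc k) \<inter> D k = D (Suc k)" using sub by blast
      moreover have "Qpn p \<inter> D k = D k" using DB[of k] B pballs_Pow by blast
      ultimately show ?thesis unfolding UD by simp
    qed
    have decay: "emeasure W (D k) \<le> ennreal (\<beta> ^ k * wmeas p w B)" for k
    proof (induction k)
      case 0
      have "emeasure W (D 0) \<le> emeasure W B" using DB by (intro emeasure_mono) auto
      then show ?case using emeasure_W[OF B, of B] by simp
    next
      case (Suc k)
      have "emeasure W (D (Suc k)) \<le> ennreal \<beta> * emeasure W (D k)" by (rule step)
      also have "\<dots> \<le> ennreal \<beta> * ennreal (\<beta> ^ k * wmeas p w B)" by (intro mult_left_mono Suc) auto
      also have "\<dots> = ennreal (\<beta> ^ Suc k * wmeas p w B)"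
        using \<beta> by (simp add: mult.assoc flip: ennreal_mult')
      finally show ?case .
    qed
    have null: "AE x in W. \<exists>k. x \<notin> D k"
    proof -
      have "(\<lambda>k. ennreal (\<beta> ^ k * wmeas p w B)) \<longlonglongrightarrow> ennreal (0 * wmeas p w B)"
        using \<beta> by (intro tendsto_ennrealI tendsto_mult LIMSEQ_power_zero tendsto_const) auto
      moreover have "emeasure W (\<Inter>k. D k) \<le> ennreal (\<beta> ^ k * wmeas p w B)" for k
        by (rule order_trans[OF emeasure_mono decay[of k]]) auto
      ultimately have "emeasure W (\<Inter>k. D k) \<le> ennreal (0 * wmeas p w B)"
        by (intro LIMSEQ_le_const) auto
      then have "(\<Inter>k. D k) \<in> null_sets W" by (auto simp: null_sets_def)
      then have "AE x in W. x \<notin> (\<Inter>k. D k)" by (rule AE_not_in)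
      then show ?thesis by auto
    qed
    \<comment> \<open>Off \<open>D k\<close> all balls about a point, up to the size of
      \<open>B\<close>, have mean at most \<open>l k\<close>; the substitute for differentiation
      turns this into a pointwise bound.\<close>
    have off: "AE x in haar p. \<forall>k. x \<in> B - D k \<longrightarrow> w x \<le> l k"
      unfolding AE_all_countable
    proof
      fix k
      show "AE x in haar p. x \<in> B - D k \<longrightarrow> w x \<le> l k"
      proof (rule AE_le_if_means_le[OF a(1), of _ G])
        fix x g assume "x \<in> B - D k" "g \<le> G"
        then show "wmeas p w (pball p g x) \<le> l k * measure (haar p) (pball p g x)"
          using a(2) by (auto simp: D_def heavy_set_def heavy_def)
      qed (use a l_pos[of k] in auto)
    qed
    \<comment> \<open>By layers: \<open>w \<le> l 0\<close> off \<open>D 0\<close>, and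
      \<open>w \<le> l (Suc k)\<close> on \<open>D k\<close> minus \<open>D (Suc k)\<close>; hence
      the shifted index in the sum.\<close>
    let ?f = "\<lambda>x. ennreal (l 0 powr \<epsilon>) * indicator B x + (\<Sum>k. ennreal (l (Suc k) powr \<epsilon>) * indicator (D k) x)"
    have "(\<integral>\<^sup>+ x. ennreal (indicator B x * w x powr (1 + \<epsilon>)) \<partial>haar p)
        = (\<integral>\<^sup>+ x. ennreal (w x) * ennreal (indicator B x * w x powr \<epsilon>) \<partial>haar p)"
    proof (rule nn_integral_cong_AE)
      show "AE x in haar p. ennreal (indicator B x * w x powr (1 + \<epsilon>))
          = ennreal (w x) * ennreal (indicator B x * w x powr \<epsilon>)"
        using w_pos by eventually_elim (auto simp: powr_add mult_ac simp flip: ennreal_mult' split: split_indicator)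
    qed
    also have "\<dots> = (\<integral>\<^sup>+ x. ennreal (indicator B x * w x powr \<epsilon>) \<partial>W)"
      by (subst nn_integral_density) auto
    also have "\<dots> \<le> (\<integral>\<^sup>+ x. ?f x \<partial>W)"
    proof (rule nn_integral_mono_AE)
      have "AE x in W. 0 < w x \<and> (\<forall>k. x \<in> B - D k \<longrightarrow> w x \<le> l k)"
        using w_pos off by (subst AE_density) auto
      then show "AE x in W. ennreal (indicator B x * w x powr \<epsilon>) \<le> ?f x"
        using null
      proof eventually_elim
        case (elim x)
        show ?case
        proof (cases "x \<in> B")
          case True
          define k where "k = (LEAST k. x \<notin> D k)"
          have k: "x \<notin> D k" unfolding k_def using elim LeastI_ex by (metis (mono_tags, lifting))
          have "w x \<le> l k" using elim True k by blast
          then have wk: "ennreal (w x powr \<epsilon>) \<le> ennreal (l k powr \<epsilon>)"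
            using elim \<epsilon> by (intro ennreal_leI powr_mono2) auto
          show ?thesis
          proof (cases k)
            case 0
            have "ennreal (w x powr \<epsilon>) \<le> ennreal (l 0 powr \<epsilon>) + 0" using wk 0 by simp
            also have "\<dots> \<le> ?f x" using True by (intro add_mono) auto
            finally show ?thesis using True by simp
          next
            case (Suc j)
            have "x \<in> D j" using not_less_Least[of j "\<lambda>k. x \<notin> D k"] Suc k_def by auto
            then have "ennreal (w x powr \<epsilon>) \<le> 0 + (\<Sum>k\<in>{j}. ennreal (l (Suc k) powr \<epsilon>) * indicator (D k) x)"
              using wk Suc by simp
            also have "\<dots> \<le> ?f x" by (intro add_mono sum_le_suminf) auto
            finally show ?thesis using True by simp
          qed
        qed simp
      qed
    qed
    also have "\<dots> = ennreal (l 0 powr \<epsilon>) * emeasure W B + (\<Sum>k. ennreal (l (Suc k) powr \<epsilon>) * emeasure W (D k))"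
      by (subst nn_integral_add, simp, simp, subst nn_integral_suminf) (auto simp: nn_integral_cmult_indicator)
    also have "\<dots> \<le> ennreal (l0 powr \<epsilon> * wmeas p w B) + (\<Sum>k. ennreal (b powr \<epsilon> * l0 powr \<epsilon> * wmeas p w B * \<rho> ^ k))"
    proof (intro add_mono suminf_le summableI)
      show "ennreal (l 0 powr \<epsilon>) * emeasure W B \<le> ennreal (l0 powr \<epsilon> * wmeas p w B)"
        using emeasure_W[OF B, of B] by (simp add: l_def ennreal_mult')
      fix k
      have "ennreal (l (Suc k) powr \<epsilon>) * emeasure W (D k) \<le> ennreal (l (Suc k) powr \<epsilon>) * ennreal (\<beta> ^ k * wmeas p w B)"
        by (intro mult_left_mono decay) auto
      also have "\<dots> = ennreal (b powr \<epsilon> * l0 powr \<epsilon> * wmeas p w B * \<rho> ^ k)"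
      proof -
        have "(b ^ k) powr \<epsilon> = (b powr \<epsilon>) ^ k" using b by (simp add: powr_power powr_powr mult.commute flip: powr_realpow)
        then have "l (Suc k) powr \<epsilon> = b powr \<epsilon> * (b powr \<epsilon>) ^ k * l0 powr \<epsilon>"
          using b l0 by (simp add: l_def powr_mult)
        then show ?thesis using wmeas_nonneg[OF weight, of B] \<beta>
          by (simp add: \<rho>_def power_mult_distrib mult_ac flip: ennreal_mult')
      qed
      finally show "ennreal (l (Suc k) powr \<epsilon>) * emeasure W (D k) \<le> ennreal (b powr \<epsilon> * l0 powr \<epsilon> * wmeas p w B * \<rho> ^ k)" .
    qed
    also have "(\<Sum>k. ennreal (b powr \<epsilon> * l0 powr \<epsilon> * wmeas p w B * \<rho> ^ k))
        = ennreal (b powr \<epsilon> * l0 powr \<epsilon> * wmeas p w B * (1 / (1 - \<rho>)))"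
      using \<rho> wmeas_nonneg[OF weight, of B]
      by (intro suminf_ennreal_eq sums_mult geometric_sums) auto
    also have "ennreal (l0 powr \<epsilon> * wmeas p w B) + \<dots> = ennreal (S * l0 powr \<epsilon> * wmeas p w B)"
      using \<rho> wmeas_nonneg[OF weight, of B]
      by (subst ennreal_plus[symmetric]) (auto simp: S_def algebra_simps)
    finally have nn: "(\<integral>\<^sup>+ x. ennreal (indicator B x * w x powr (1 + \<epsilon>)) \<partial>haar p) \<le> ennreal (S * l0 powr \<epsilon> * wmeas p w B)" .
    have int: "integrable (haar p) (\<lambda>x. indicator B x * w x powr (1 + \<epsilon>))"
      using nn by (intro integrableI_nonneg) (auto intro: order_le_less_trans)
    have "ennreal (LINT x:B|haar p. w x powr (1 + \<epsilon>)) \<le> ennreal (S * l0 powr \<epsilon> * wmeas p w B)"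
      using nn nn_integral_eq_integral[OF int] by (simp add: set_lebesgue_integral_def)
    then have "(LINT x:B|haar p. w x powr (1 + \<epsilon>)) \<le> S * l0 powr \<epsilon> * (l0 * measure (haar p) B)"
      using S l0 mB by (subst (asm) ennreal_le_iff) (auto simp: wB)
    then have "avg p B (\<lambda>x. w x powr (1 + \<epsilon>)) \<le> S * (l0 * l0 powr \<epsilon>)"
      unfolding avg_def using mB by (simp add: field_simps)
    moreover have "l0 * l0 powr \<epsilon> = l0 powr (1 + \<epsilon>)" using l0 by (simp add: powr_add)
    ultimately show ?thesis using int by (simp add: set_integrable_def l0_def)
  qed
  have "RH p (1 + \<epsilon>) w"
    unfolding RH_def
  proof (intro conjI ballI exI[of _ "S powr (1 / (1 + \<epsilon>))"])
    fix B :: "('n \<Rightarrow> int \<Rightarrow> nat) set" assume B: "B \<in> pballs p"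
    show "set_integrable (haar p) B (\<lambda>x. w x powr (1 + \<epsilon>))" using main[OF B] by simp
    have a0: "0 \<le> avg p B w" using wmeas_nonneg[OF weight, of B] by (simp add: avg_def wmeas_def)
    have "0 \<le> avg p B (\<lambda>x. w x powr (1 + \<epsilon>))"
      unfolding avg_def set_lebesgue_integral_def by (auto intro!: divide_nonneg_nonneg integral_nonneg_AE)
    then have "avg p B (\<lambda>x. w x powr (1 + \<epsilon>)) powr (1 / (1 + \<epsilon>)) \<le> (S * avg p B w powr (1 + \<epsilon>)) powr (1 / (1 + \<epsilon>))"
      using main[OF B] \<epsilon> by (intro powr_mono2) auto
    also have "\<dots> = S powr (1 / (1 + \<epsilon>)) * avg p B w"
      using S a0 \<epsilon> by (simp add: powr_mult powr_powr)
    finally show "avg p B (\<lambda>x. w x powr (1 + \<epsilon>)) powr (1 / (1 + \<epsilon>)) \<le> S powr (1 / (1 + \<epsilon>)) * avg p B w" .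
  qed
  then show ?thesis using \<epsilon> by (intro exI[of _ "1 + \<epsilon>"]) auto
qed

end

subsection \<open>The Hausdorff operator\<close>

text \<open>Concavity of \<open>t powr e\<close>, obtained from
  \<open>a^e b^(1 - e) \<le> e a + (1 - e) b\<close> after multiplication by
  \<open>b^(e - 1)\<close>.\<close>

lemma powr_step_le:
  fixes a b e :: real
  assumes a: "0 \<le> a" and b: "0 < b" and e: "0 < e" "e < 1"
  shows "b powr (e - 1) * (b - a) \<le> (b powr e - a powr e) / e"
proof -
  have "(\<Prod>t\<in>UNIV. (if t then a else b) powr (if t then e else 1 - e))
      \<le> (\<Sum>t\<in>UNIV. (if t then e else 1 - e) * (if t then a else b))"
    using a b e by (intro weighted_arith_geom_mean) (auto simp: UNIV_bool)
  then have "a powr e * b powr (1 - e) \<le> e * a + (1 - e) * b"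
    by (simp add: UNIV_bool mult.commute add.commute)
  then have "b powr (e - 1) * (a powr e * b powr (1 - e)) \<le> b powr (e - 1) * (e * a + (1 - e) * b)"
    by (rule mult_left_mono) simp
  moreover have "b powr (e - 1) * (a powr e * b powr (1 - e)) = a powr e"
    using b by (simp add: mult.left_commute flip: powr_add)
  moreover have "b powr (e - 1) * (e * a + (1 - e) * b) = b powr (e - 1) * b - e * (b powr (e - 1) * (b - a))"
    by (simp add: algebra_simps)
  moreover have "b powr (e - 1) * b = b powr e" using b powr_add[of b "e - 1" 1] by simp
  ultimately have "a powr e \<le> b powr e - e * (b powr (e - 1) * (b - a))" by simp
  then show ?thesis using e by (simp add: field_simps)
qed

context padic
begin

lemma wmeas_Bg_pos: "is_weight p w \<Longrightarrow> 0 < wmeas p w (Bg p g)"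
  by (rule wmeas_pos) auto

lemma measure_Bg:
  "measure (haar p) (Bg p g :: ('n::finite \<Rightarrow> int \<Rightarrow> nat) set) = real p powr (real CARD('n) * real_of_int g)"
  unfolding Bg_eq_pball by (rule measure_pball) simp

text \<open>Hoelder's inequality for \<open>w\<close> times the indicator of \<open>E\<close>, with
  exponent \<open>r\<close> on \<open>w\<close>. It complements the \<open>A\<^sub>\<zeta>\<close>
  comparison: a small share of the measure carries only a small share of the mass.\<close>

lemma RH_subset:
  fixes w :: "('n::finite \<Rightarrow> int \<Rightarrow> nat) \<Rightarrow> real"
  assumes w: "is_weight p w" and RH: "RH p r w" and r: "1 < r"
  obtains C where "0 < C"
    "\<And>B E. B \<in> pballs p \<Longrightarrow> E \<in> sets (haar p) \<Longrightarrow> E \<subseteq> B \<Longrightarrow>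
       wmeas p w E \<le> C * (measure (haar p) E / measure (haar p) B) powr (1 - 1 / r) * wmeas p w B"
proof -
  obtain C where rint: "\<And>B. B \<in> pballs p \<Longrightarrow> set_integrable (haar p) B (\<lambda>x. w x powr r)"
    and C: "\<And>B. B \<in> pballs p \<Longrightarrow> avg p B (\<lambda>x. w x powr r) powr (1 / r) \<le> C * avg p B w"
    using RH unfolding RH_def by blast
  have [measurable]: "w \<in> borel_measurable (haar p)" and wpos: "AE x in haar p. 0 < w x"
    using w by (auto simp: is_weight_def)
  show ?thesis
  proof (rule that[of "max C 1"], simp)
    fix B E :: "('n \<Rightarrow> int \<Rightarrow> nat) set"
    assume B: "B \<in> pballs p" and E [measurable]: "E \<in> sets (haar p)" and EB: "E \<subseteq> B"
    have [measurable]: "B \<in> sets (haar p)" using B by (rule pballs_sets)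
    let ?m = "measure (haar p) B" and ?R = "LINT x:B|haar p. w x powr r"
    have m: "0 < ?m" by (rule measure_pballs_pos[OF B])
    have finE: "emeasure (haar p) E < \<infinity>"
      using emeasure_mono[OF EB, of "haar p"] emeasure_pballs_finite[OF B] by (simp add: order_le_less_trans)
    define G where "G t x = (if t then indicator B x * w x powr r else indicator E x)" for t x
    define e where "e t = (if t then 1 / r else 1 - 1 / r)" for t
    have Gint: "integrable (haar p) (G t)" for t
      using rint[OF B] finE unfolding G_def set_integrable_def by (cases t) auto
    have G0: "0 \<le> G t x" for t x by (simp add: G_def)
    have e: "0 < e t" for t using r by (simp add: e_def)
    have e1: "(\<Sum>t\<in>UNIV. e t) = 1" by (simp add: e_def UNIV_bool)
    note H = Holder_prod[OF finite_class.finite_UNIV e e1 Gint G0]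
    have eq: "AE x in haar p. (\<Prod>t\<in>UNIV. G t x powr e t) = indicator E x * w x"
      using wpos by eventually_elim
        (use EB r in \<open>auto simp: UNIV_bool G_def e_def powr_powr split: split_indicator\<close>)
    have R0: "0 \<le> ?R" unfolding set_lebesgue_integral_def by (rule integral_nonneg_AE) auto
    have E': "(\<integral>x. G False x \<partial>haar p) = measure (haar p) E"
      using sets.sets_into_space[OF E] by (simp add: G_def Int_absorb2)
    have R': "(\<integral>x. G True x \<partial>haar p) = ?R"
      by (simp add: G_def set_lebesgue_integral_def)
    have "wmeas p w E = (\<integral>x. (\<Prod>t\<in>UNIV. G t x powr e t) \<partial>haar p)"
      unfolding wmeas_def set_lebesgue_integral_def using H(1) by (subst integral_cong_AE[OF _ _ eq]) auto
    also have "\<dots> \<le> (\<Prod>t\<in>UNIV. (\<integral>x. G t x \<partial>haar p) powr e t)" by (rule H(2))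
    also have "\<dots> = ?R powr (1 / r) * measure (haar p) E powr (1 - 1 / r)"
      by (simp add: UNIV_bool E' R' e_def mult.commute)
    also have "?R powr (1 / r) = ?m powr (1 / r) * avg p B (\<lambda>x. w x powr r) powr (1 / r)"
      unfolding avg_def using R0 m by (simp add: powr_divide)
    also have "\<dots> \<le> ?m powr (1 / r) * (max C 1 * avg p B w)"
    proof (rule mult_left_mono)
      have "0 \<le> avg p B w" using wmeas_nonneg[OF w, of B] by (simp add: avg_def wmeas_def)
      then have "C * avg p B w \<le> max C 1 * avg p B w" by (intro mult_right_mono) auto
      then show "avg p B (\<lambda>x. w x powr r) powr (1 / r) \<le> max C 1 * avg p B w" using C[OF B] by simp
    qed simp
    finally have "wmeas p w E \<le> ?m powr (1 / r) * (max C 1 * (wmeas p w B / ?m)) * measure (haar p) E powr (1 - 1 / r)"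
      by (simp add: avg_def wmeas_def mult_right_mono)
    also have "\<dots> = max C 1 * (measure (haar p) E / ?m) powr (1 - 1 / r) * wmeas p w B"
    proof -
      have "?m powr (1 / r) / ?m = 1 / ?m powr (1 - 1 / r)"
        using m by (simp add: powr_diff)
      then show ?thesis using m by (simp add: powr_divide field_simps)
    qed
    finally show "wmeas p w E \<le> max C 1 * (measure (haar p) E / ?m) powr (1 - 1 / r) * wmeas p w B" .
  qed
qed

text \<open>Substituting \<open>z = p^j y\<close> carries \<open>S\<^sub>0\<close> into the ball of
  radius \<open>p^-j\<close>, and the reciprocal of that ball's measure is exactly the Jacobian
  factor \<open>p^(n j)\<close>. So the integral is bounded by a mean, to which
  \<open>A\<^sub>\<zeta>\<close> applies.\<close>

lemma integral_Sg_pdil_le: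
  fixes h :: "('n::finite \<Rightarrow> int \<Rightarrow> nat) \<Rightarrow> real"
  assumes [measurable]: "h \<in> borel_measurable (haar p)" and h0: "\<And>y. 0 \<le> h y"
    and int: "set_integrable (haar p) (Bg p (- j)) h"
  shows "integrable (haar p) (\<lambda>y. indicator (Sg p 0) y * h (pdil j y))"
    and "(\<integral>y. indicator (Sg p 0) y * h (pdil j y) \<partial>haar p) \<le> avg p (Bg p (- j)) h"
proof -
  let ?B = "Bg p (- j) :: ('n \<Rightarrow> int \<Rightarrow> nat) set"
  let ?c = "real p powr (real CARD('n) * real_of_int j)"
  have i: "integrable (haar p) (\<lambda>z. indicator ?B z * h z)" using int by (simp add: set_integrable_def)
  have I0: "0 \<le> (LINT z:?B|haar p. h z)" unfolding set_lebesgue_integral_def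
    using h0 by (intro integral_nonneg_AE) auto
  have "(\<integral>\<^sup>+ y. ennreal (indicator (Sg p 0) y * h (pdil j y)) \<partial>haar p)
      \<le> (\<integral>\<^sup>+ y. ennreal (indicator ?B (pdil j y) * h (pdil j y)) \<partial>haar p)"
  proof (rule nn_integral_mono)
    fix y :: "'n \<Rightarrow> int \<Rightarrow> nat"
    have "y \<in> Sg p 0 \<Longrightarrow> pdil j y \<in> ?B" using Sg_subset_Bg[of 0] pdil_Bg[of y 0 j] by auto
    then show "ennreal (indicator (Sg p 0) y * h (pdil j y)) \<le> ennreal (indicator ?B (pdil j y) * h (pdil j y))"
      using h0 by (intro ennreal_leI) (auto split: split_indicator)
  qed
  also have "\<dots> = ennreal ?c * (\<integral>\<^sup>+ z. ennreal (indicator ?B z * h z) \<partial>haar p)"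
    by (rule nn_integral_pdil) measurable
  also have "\<dots> = ennreal (?c * (LINT z:?B|haar p. h z))"
    using nn_integral_eq_integral[OF i] h0 I0
    by (simp add: set_lebesgue_integral_def ennreal_mult)
  also have "?c * (LINT z:?B|haar p. h z) = avg p ?B h"
    by (simp add: avg_def measure_Bg powr_minus field_simps)
  finally have nn: "(\<integral>\<^sup>+ y. ennreal (indicator (Sg p 0) y * h (pdil j y)) \<partial>haar p) \<le> ennreal (avg p ?B h)" .
  show i': "integrable (haar p) (\<lambda>y. indicator (Sg p 0) y * h (pdil j y))"
    using nn h0 by (intro integrableI_nonneg) (auto intro: order_le_less_trans)
  have "0 \<le> avg p ?B h" using I0 by (simp add: avg_def)
  then show "(\<integral>y. indicator (Sg p 0) y * h (pdil j y) \<partial>haar p) \<le> avg p ?B h"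
    using nn nn_integral_eq_integral[OF i'] h0 by simp
qed

section \<open>Central Morrey norms\<close>

lemma Bterm_nonneg: "0 \<le> Bterm p s \<mu> w f g"
  by (simp add: Bterm_def)

lemma Bterm_le_Bnorm: "Bmem p s \<mu> w f \<Longrightarrow> Bterm p s \<mu> w f g \<le> Bnorm p s \<mu> w f"
  unfolding Bnorm_def Bmem_def by (intro cSUP_upper) auto

lemma Bnorm_nonneg: "Bmem p s \<mu> w f \<Longrightarrow> 0 \<le> Bnorm p s \<mu> w f"
  using Bterm_le_Bnorm[of s \<mu> w f 0] Bterm_nonneg[of s \<mu> w f 0] by simp

text \<open>Distributing the exponent \<open>1 / s\<close> in \<open>Bterm\<close> splits off the
  power \<open>\<mu>\<close> of the mass and leaves a mean with respect to the weight, which is what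
  the \<open>A\<^sub>\<zeta>\<close> estimate produces.\<close>

lemma mean_le_Bnorm:
  assumes w: "is_weight p w" and s: "0 < s" and f: "Bmem p s \<mu> w f"
  shows "((LINT x:Bg p g|haar p. norm (f x) powr s * w x) / wmeas p w (Bg p g)) powr (1 / s)
    \<le> wmeas p w (Bg p g) powr \<mu> * Bnorm p s \<mu> w f"
proof -
  let ?X = "LINT x:Bg p g|haar p. norm (f x) powr s * w x" and ?W = "wmeas p w (Bg p g)"
  have W: "0 < ?W" by (rule wmeas_Bg_pos[OF w])
  have X: "0 \<le> ?X" unfolding set_lebesgue_integral_def
    by (rule integral_nonneg_AE) (use w in \<open>auto simp: is_weight_def elim!: eventually_mono\<close>)
  have "Bterm p s \<mu> w f g = ?W powr ((- 1 - \<mu> * s) / s) * ?X powr (1 / s)"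
    using W X by (simp add: Bterm_def powr_mult powr_powr)
  also have "(- 1 - \<mu> * s) / s = - \<mu> + - (1 / s)" using s by (simp add: field_simps)
  also have "?W powr \<dots> = ?W powr - \<mu> / ?W powr (1 / s)"
    unfolding powr_add by (simp add: powr_minus field_simps)
  finally have "(?X / ?W) powr (1 / s) = ?W powr \<mu> * Bterm p s \<mu> w f g"
    using W X by (simp add: powr_divide powr_minus field_simps)
  also have "\<dots> \<le> ?W powr \<mu> * Bnorm p s \<mu> w f"
    by (intro mult_left_mono Bterm_le_Bnorm[OF f]) simp
  finally show ?thesis .
qed

text \<open>The ball is cut into spheres of radius \<open>p^(g - k)\<close>, whose masses are
  differences of consecutive ball masses \<open>b k\<close>. The integral is then bounded by
  \<open>R powr s\<close> times a sum of \<open>b k powr (e - 1) * (b k - b (Suc k))\<close> with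
  \<open>e - 1 = \<mu> * s\<close>. Such a sum is a lower Riemann sum of the decreasing function
  \<open>t powr (e - 1)\<close> and stays below \<open>b 0 powr e / e\<close>.\<close>

lemma Bnorm_radial_le:
  fixes w :: "('n::finite \<Rightarrow> int \<Rightarrow> nat) \<Rightarrow> real" and H :: "('n \<Rightarrow> int \<Rightarrow> nat) \<Rightarrow> complex"
  assumes w: "is_weight p w" and s: "0 < s" and \<mu>: "\<mu> < 0" "0 < 1 + \<mu> * s"
    and Hm [measurable]: "H \<in> borel_measurable (haar p)" and R: "0 \<le> R"
    and le: "\<And>x v. x \<in> Sg p v \<Longrightarrow> norm (H x) \<le> R * wmeas p w (Bg p v) powr \<mu>"
  shows "Bmem p s \<mu> w H" "Bnorm p s \<mu> w H \<le> R * (1 / (1 + \<mu> * s)) powr (1 / s)"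
proof -
  have [measurable]: "w \<in> borel_measurable (haar p)" and wpos: "AE x in haar p. 0 < w x"
    using w by (auto simp: is_weight_def)
  define e where "e = 1 + \<mu> * s"
  have "\<mu> * s < 0" using \<mu>(1) s by (rule mult_neg_pos)
  then have e: "0 < e" "e < 1" using \<mu> by (auto simp: e_def)
  let ?F = "\<lambda>x. norm (H x) powr s * w x"
  have bound: "set_integrable (haar p) (Bg p g) ?F \<and>
      (LINT x:Bg p g|haar p. ?F x) \<le> R powr s * (wmeas p w (Bg p g) powr e / e)" for g
  proof -
    define b where "b k = wmeas p w (Bg p (g - int k))" for k
    have b: "0 < b k" for k unfolding b_def by (rule wmeas_Bg_pos[OF w])
    define c where "c k = R powr s * b k powr (e - 1)" for k
    have c0: "0 \<le> c k" for k by (simp add: c_def)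
    have sph: "(\<integral>\<^sup>+ x. ennreal (indicator (Sg p (g - int k)) x * w x) \<partial>haar p) = ennreal (b k - b (Suc k))" for k
    proof -
      let ?W = "density (haar p) (\<lambda>x. ennreal (w x))"
      have "(\<integral>\<^sup>+ x. ennreal (indicator (Sg p (g - int k)) x * w x) \<partial>haar p) = emeasure ?W (Sg p (g - int k))"
        by (subst emeasure_density) (auto intro!: nn_integral_cong split: split_indicator)
      also have "\<dots> = emeasure ?W (Bg p (g - int k)) - emeasure ?W (Bg p (g - int k - 1))"
        unfolding Sg_eq_diff using Bg_mono[of "g - int k - 1" "g - int k"]
          emeasure_density_weight[OF w Bg_pballs sets_Bg, of "g - int k - 1" "g - int k - 1"]
        by (intro emeasure_Diff) auto
      also have "\<dots> = ennreal (b k - b (Suc k))"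
        using emeasure_density_weight[OF w Bg_pballs sets_Bg order_refl] b[of "Suc k"]
        by (simp add: b_def ennreal_minus algebra_simps)
      finally show ?thesis .
    qed
    have "(\<integral>\<^sup>+ x. ennreal (indicator (Bg p g) x * ?F x) \<partial>haar p)
        \<le> (\<integral>\<^sup>+ x. (\<Sum>k. ennreal (c k) * ennreal (indicator (Sg p (g - int k)) x * w x)) \<partial>haar p)"
    proof (rule nn_integral_mono_AE)
      \<comment> \<open>The origin lies on no sphere and is excluded as a null set.\<close>
      show "AE x in haar p. ennreal (indicator (Bg p g) x * ?F x)
          \<le> (\<Sum>k. ennreal (c k) * ennreal (indicator (Sg p (g - int k)) x * w x))"
        using wpos AE_not_in[OF null_vnorm_zero]
      proof eventually_elim
        case (elim x)
        show ?case
        proof (cases "x \<in> Bg p g")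
          case True
          then have "x \<in> Qpn p" by (simp add: Bg_def)
          then have xS: "x \<in> Sg p (vexp p x)" using elim Sg_vexp by simp
          have "real p powr real_of_int (vexp p x) \<le> real p powr real_of_int g"
            using True xS by (simp add: Bg_def Sg_def)
          then have "vexp p x \<le> g" by simp
          then have k: "vexp p x = g - int (nat (g - vexp p x))" by simp
          define k where "k = nat (g - vexp p x)"
          have xk: "x \<in> Sg p (g - int k)" using xS k by (simp add: k_def)
          have "norm (H x) powr s \<le> (R * b k powr \<mu>) powr s"
            using le[OF xk] s by (intro powr_mono2) (auto simp: b_def)
          also have "\<dots> = c k" using R by (simp add: c_def e_def powr_mult powr_powr)
          finally have "ennreal (indicator (Bg p g) x * ?F x) \<le> ennreal (c k) * ennreal (indicator (Sg p (g - int k)) x * w x)"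
            using True xk elim c0[of k] by (simp add: ennreal_leI mult_right_mono flip: ennreal_mult)
          also have "\<dots> = (\<Sum>k\<in>{k}. ennreal (c k) * ennreal (indicator (Sg p (g - int k)) x * w x))" by simp
          also have "\<dots> \<le> (\<Sum>k. ennreal (c k) * ennreal (indicator (Sg p (g - int k)) x * w x))"
            by (intro sum_le_suminf) auto
          finally show ?thesis .
        qed simp
      qed
    qed
    also have "\<dots> = (\<Sum>k. ennreal (c k) * ennreal (b k - b (Suc k)))"
      by (subst nn_integral_suminf) (auto simp: nn_integral_cmult sph)
    also have "\<dots> \<le> ennreal (R powr s * (b 0 powr e / e))"
    proof (rule suminf_le_const[OF summableI])
      fix N
      have mono: "b (Suc k) \<le> b k" for k
        unfolding b_def by (rule wmeas_mono[OF w Bg_pballs _ _ Bg_mono order_refl]) auto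
      have "(\<Sum>k<N. ennreal (c k) * ennreal (b k - b (Suc k))) = ennreal (\<Sum>k<N. c k * (b k - b (Suc k)))"
        using c0 mono by (subst sum_ennreal[symmetric]) (auto simp: ennreal_mult)
      also have "\<dots> \<le> ennreal (\<Sum>k<N. R powr s * ((b k powr e - b (Suc k) powr e) / e))"
      proof (intro ennreal_leI sum_mono)
        fix k
        have "R powr s * (b k powr (e - 1) * (b k - b (Suc k))) \<le> R powr s * ((b k powr e - b (Suc k) powr e) / e)"
          using b e by (intro mult_left_mono powr_step_le) (auto intro: less_imp_le)
        then show "c k * (b k - b (Suc k)) \<le> R powr s * ((b k powr e - b (Suc k) powr e) / e)"
          by (simp add: c_def mult.assoc)
      qed
      also have "(\<Sum>k<N. R powr s * ((b k powr e - b (Suc k) powr e) / e)) = R powr s * ((b 0 powr e - b N powr e) / e)"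
        by (simp only: sum_distrib_left[symmetric] sum_divide_distrib[symmetric] sum_lessThan_telescope'[of "\<lambda>k. b k powr e"])
      \<comment> \<open>Only the sign of \<open>b N powr e\<close> is used, so the bound is uniform
        in \<open>N\<close>.\<close>
      also have "\<dots> \<le> R powr s * (b 0 powr e / e)"
        using e by (intro mult_left_mono divide_right_mono) auto
      finally show "(\<Sum>k<N. ennreal (c k) * ennreal (b k - b (Suc k))) \<le> ennreal (R powr s * (b 0 powr e / e))"
        by (simp add: ennreal_leI)
    qed
    finally have nn: "(\<integral>\<^sup>+ x. ennreal (indicator (Bg p g) x * ?F x) \<partial>haar p) \<le> ennreal (R powr s * (wmeas p w (Bg p g) powr e / e))"
      by (simp add: b_def)
    have ae: "AE x in haar p. 0 \<le> indicator (Bg p g) x * ?F x" using wpos by (auto elim!: eventually_mono)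
    have i: "integrable (haar p) (\<lambda>x. indicator (Bg p g) x * ?F x)"
      using nn ae by (intro integrableI_nonneg) (auto intro: order_le_less_trans)
    have "0 \<le> R powr s * (wmeas p w (Bg p g) powr e / e)" using e by simp
    then have "(\<integral>x. indicator (Bg p g) x * ?F x \<partial>haar p) \<le> R powr s * (wmeas p w (Bg p g) powr e / e)"
      using nn nn_integral_eq_integral[OF i ae] by simp
    then show ?thesis using i by (simp add: set_integrable_def set_lebesgue_integral_def)
  qed
  have bterm: "Bterm p s \<mu> w H g \<le> R * (1 / e) powr (1 / s)" for g
  proof -
    let ?W = "wmeas p w (Bg p g)" and ?I = "LINT x:Bg p g|haar p. ?F x"
    have W: "0 < ?W" by (rule wmeas_Bg_pos[OF w])
    have I0: "0 \<le> ?I" unfolding set_lebesgue_integral_def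
      by (rule integral_nonneg_AE) (use wpos in \<open>auto elim!: eventually_mono\<close>)
    have "?W powr (- 1 - \<mu> * s) * ?I \<le> ?W powr (- 1 - \<mu> * s) * (R powr s * (?W powr e / e))"
      using bound[of g] by (intro mult_left_mono) auto
    also have "\<dots> = R powr s * (1 / e) * (?W powr (- 1 - \<mu> * s) * ?W powr e)" by simp
    also have "?W powr (- 1 - \<mu> * s) * ?W powr e = 1" using W by (simp add: e_def flip: powr_add)
    finally have "Bterm p s \<mu> w H g \<le> (R powr s * (1 / e)) powr (1 / s)"
      unfolding Bterm_def using s I0 by (intro powr_mono2) auto
    also have "\<dots> = R * (1 / e) powr (1 / s)" using R s e by (simp add: powr_mult powr_powr powr_divide)
    finally show ?thesis .
  qed
  show "Bmem p s \<mu> w H"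
    unfolding Bmem_def
  proof (intro conjI ballI)
    fix B :: "('n \<Rightarrow> int \<Rightarrow> nat) set" assume B: "B \<in> pballs p"
    obtain g a where "a \<in> Qpn p" "B = pball p g a" using B by (rule pballs_E)
    then obtain h where "B \<subseteq> Bg p h" using pball_subset_Bg by metis
    then show "set_integrable (haar p) B ?F"
      using bound[of h] pballs_sets[OF B] by (blast intro: set_integrable_subset)
  next
    show "bdd_above (range (Bterm p s \<mu> w H))" using bterm by (auto intro!: bdd_aboveI)
  qed (rule Hm)
  show "Bnorm p s \<mu> w H \<le> R * (1 / (1 + \<mu> * s)) powr (1 / s)"
    unfolding Bnorm_def using bterm by (intro cSUP_least) (auto simp: e_def)
qed

text \<open>The value depends on \<open>x\<close> only through its norm, so the operator factors
  through a countable discrete space. Measurability then holds whatever the inner integrals and the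
  sum are.\<close>

lemma Hop_measurable:
  "Hop p \<Phi> \<Omega> m fs \<in> borel_measurable (haar p :: ('n::finite \<Rightarrow> int \<Rightarrow> nat) measure)"
proof -
  \<comment> \<open>\<open>None\<close> stands for the origin, where \<open>vexp\<close> carries no
    information.\<close>
  define t where "t x = (if vnorm p x = 0 then None else Some (vexp p x))" for x :: "'n \<Rightarrow> int \<Rightarrow> nat"
  define F where "F o' = (case o' of None \<Rightarrow> 0 | Some v \<Rightarrow>
     (\<Sum>\<^sub>\<infinity>g\<in>(UNIV::int set). LINT y:Sg p 0|haar p.
         complex_of_real (\<Phi> (ppow g) / real p powr real_of_int g) * \<Omega> y
         * (\<Prod>i<m. fs i (pdil (g - v) y))))" for o'
  have "Hop p \<Phi> \<Omega> m fs = (\<lambda>x. F (t x))"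
    by (auto simp: fun_eq_iff Hop_def F_def t_def)
  moreover have "t \<in> measurable (haar p) (count_space UNIV)"
  proof (subst measurable_count_space_eq2_countable, intro conjI ballI)
    fix o' :: "int option"
    show "t -` {o'} \<inter> space (haar p) \<in> sets (haar p)"
    proof (cases o')
      case None
      then have "t -` {o'} \<inter> space (haar p) = {x \<in> Qpn p. vnorm p x = 0}" by (auto simp: t_def split: if_splits)
      then show ?thesis using null_vnorm_zero by auto
    next
      case (Some v)
      have "x \<in> t -` {o'} \<inter> space (haar p) \<longleftrightarrow> x \<in> Sg p v" for x
        using Some vexp_Sg[of x v] Sg_vexp[of x] sets.sets_into_space[OF sets_Sg[of v]]
        by (auto simp: t_def split: if_splits)
      then have "t -` {o'} \<inter> space (haar p) = Sg p v" by blast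
      then show ?thesis by simp
    qed
  qed auto
  ultimately show ?thesis by (simp add: measurable_compose[OF _ measurable_count_space])
qed

text \<open>The constant is fixed before the functions and the dilation \<open>j\<close>: it depends
  only on the weight, the exponents and \<open>\<Omega>\<close>, so it can be pulled out of the
  later sum over \<open>g\<close>. The masses appear with powers \<open>lams i\<close> from the
  single norms, and these multiply to the sum of the \<open>lams i\<close>.\<close>

lemma norm_sphere_integral_le:
  fixes m :: nat and qs lams :: "nat \<Rightarrow> real" and \<Omega> :: "('n::finite \<Rightarrow> int \<Rightarrow> nat) \<Rightarrow> complex" and w :: "('n \<Rightarrow> int \<Rightarrow> nat) \<Rightarrow> real"
  assumes A: "A_weight p \<zeta> w" and z: "1 \<le> \<zeta>" and qs: "\<forall>i<m. 1 \<le> qs i"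
    and q: "1 / q = (\<Sum>i<m. 1 / qs i)" and zq: "\<zeta> < q"
    and \<Omega> [measurable]: "\<Omega> \<in> borel_measurable (haar p)"
    and \<Omega>int: "set_integrable (haar p) (Sg p 0) (\<lambda>y. norm (\<Omega> y) powr ((q / \<zeta>) / (q / \<zeta> - 1)))"
  obtains C where "0 \<le> C"
    "\<And>fs j. (\<forall>i<m. Bmem p (qs i) (lams i) w (fs i)) \<Longrightarrow>
       (\<integral>y. indicator (Sg p 0) y * (norm (\<Omega> y) * (\<Prod>i<m. norm (fs i (pdil j y)))) \<partial>haar p)
       \<le> C * wmeas p w (Bg p (- j)) powr (\<Sum>i<m. lams i) * (\<Prod>i<m. Bnorm p (qs i) (lams i) w (fs i))"
proof -
  have w: "is_weight p w" using A by (simp add: A_weight_def)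
  have z0: "0 < \<zeta>" and q0: "0 < q" using z zq by auto
  obtain K where K1: "1 \<le> K" and K: "\<And>B u. B \<in> pballs p \<Longrightarrow> u \<in> borel_measurable (haar p) \<Longrightarrow> (\<And>x. 0 \<le> u x) \<Longrightarrow>
       set_integrable (haar p) B (\<lambda>x. u x powr \<zeta> * w x) \<Longrightarrow>
       set_integrable (haar p) B u \<and>
       avg p B u powr \<zeta> \<le> K * (LINT x:B|haar p. u x powr \<zeta> * w x) / wmeas p w B"
    using A_weight_avg[OF A z] by blast
  define s where "s = (q / \<zeta>) / (q / \<zeta> - 1)"
  have s: "s * (1 - \<zeta> / q) = 1" using z0 zq q0 by (simp add: s_def field_simps)
  define I\<Omega> where "I\<Omega> = (LINT y:Sg p 0|haar p. norm (\<Omega> y) powr s)"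
  define C where "C = (\<Prod>i<m. K powr (1 / qs i)) * I\<Omega> powr (1 - \<zeta> / q)"
  show ?thesis
  proof (rule that[of C])
    show "0 \<le> C" unfolding C_def by (intro mult_nonneg_nonneg prod_nonneg) auto
    fix fs :: "nat \<Rightarrow> ('n \<Rightarrow> int \<Rightarrow> nat) \<Rightarrow> complex" and j :: int
    assume fs: "\<forall>i<m. Bmem p (qs i) (lams i) w (fs i)"
    have fsm: "fs i \<in> borel_measurable (haar p)" if "i < m" for i using fs that by (simp add: Bmem_def)
    let ?B = "Bg p (- j) :: ('n \<Rightarrow> int \<Rightarrow> nat) set"
    let ?S = "indicator (Sg p 0) :: _ \<Rightarrow> real"
    have W: "0 < wmeas p w ?B" by (rule wmeas_Bg_pos[OF w])
    \<comment> \<open>With the power \<open>qs i / \<zeta>\<close>, raising \<open>h i\<close> to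
      \<open>\<zeta>\<close> gives the integrand of the norm, and the Hoelder exponent
      \<open>\<zeta> / qs i\<close> gives back \<open>norm (fs i z)\<close>.\<close>
    define h where "h i z = norm (fs i z) powr (qs i / \<zeta>)" for i z
    have hm: "h i \<in> borel_measurable (haar p)" if "i < m" for i
      unfolding h_def using fsm[OF that] by measurable
    have h0: "0 \<le> h i z" for i z by (simp add: h_def)
    have hz: "h i x powr \<zeta> = norm (fs i x) powr qs i" for i x
      using z0 by (simp add: h_def powr_powr)
    let ?X = "\<lambda>i. LINT x:?B|haar p. norm (fs i x) powr qs i * w x"
    have hB: "set_integrable (haar p) ?B (h i) \<and> avg p ?B (h i) powr \<zeta> \<le> K * ?X i / wmeas p w ?B"
      if "i < m" for i
      using K[OF Bg_pballs hm[OF that] h0, of "- j"] fs that by (simp add: hz Bmem_def)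
    \<comment> \<open>Index \<open>m\<close>, one past the functions, holds
      \<open>\<Omega>\<close>.\<close>
    define G where "G i y = (if i < m then ?S y * h i (pdil j y) else ?S y * norm (\<Omega> y) powr s)" for i y
    define a where "a i = (if i < m then \<zeta> / qs i else 1 - \<zeta> / q)" for i
    have Gint: "integrable (haar p) (G i)" if "i \<in> {..<Suc m}" for i
      using integral_Sg_pdil_le(1)[OF hm h0, of i j] hB[of i] \<Omega>int[folded s_def]
      by (cases "i < m") (auto simp: G_def[abs_def] set_integrable_def)
    have G0: "0 \<le> G i y" for i y by (simp add: G_def h0)
    have a0: "0 < a i" if "i \<in> {..<Suc m}" for i
      using z0 q0 zq qs by (auto simp: a_def intro: less_le_trans[of 0 1])
    have a1: "(\<Sum>i<Suc m. a i) = 1"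
    proof -
      have "(\<Sum>i<m. a i) = (\<Sum>i<m. \<zeta> * (1 / qs i))" by (intro sum.cong) (auto simp: a_def)
      also have "\<dots> = \<zeta> / q" using q by (simp only: sum_distrib_left[symmetric] flip: q) simp
      finally show ?thesis by (simp add: a_def)
    qed
    note H = Holder_prod[OF finite_lessThan a0 a1 Gint G0]
    have Gm: "G m y powr a m = ?S y * norm (\<Omega> y)" for y
      using s by (simp add: G_def a_def powr_powr split: split_indicator)
    have Gi: "G i y powr a i = ?S y * norm (fs i (pdil j y))" if "i < m" for i y
    proof -
      have "qs i / \<zeta> * (\<zeta> / qs i) = 1" using qs that z0 by fastforce
      then show ?thesis using that by (simp add: G_def a_def h_def powr_powr split: split_indicator)
    qed
    have "?S y * (norm (\<Omega> y) * (\<Prod>i<m. norm (fs i (pdil j y)))) = (\<Prod>i<Suc m. G i y powr a i)" for y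
    proof (cases "y \<in> Sg p 0")
      case True
      have "(\<Prod>i<m. G i y powr a i) = (\<Prod>i<m. norm (fs i (pdil j y)))"
        using True Gi by (intro prod.cong) auto
      then show ?thesis using True Gm[of y] by (simp add: mult.commute)
    next
      case False
      then show ?thesis using Gm[of y] by simp
    qed
    then have "(\<integral>y. ?S y * (norm (\<Omega> y) * (\<Prod>i<m. norm (fs i (pdil j y)))) \<partial>haar p)
        = (\<integral>y. (\<Prod>i<Suc m. G i y powr a i) \<partial>haar p)" by simp
    also have "\<dots> \<le> (\<Prod>i<Suc m. (\<integral>y. G i y \<partial>haar p) powr a i)" by (rule H(2))
    also have "\<dots> = (\<Prod>i<m. (\<integral>y. G i y \<partial>haar p) powr a i) * I\<Omega> powr (1 - \<zeta> / q)"
      by (simp add: G_def a_def I\<Omega>_def set_lebesgue_integral_def)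
    also have "\<dots> \<le> (\<Prod>i<m. K powr (1 / qs i) * (wmeas p w ?B powr lams i * Bnorm p (qs i) (lams i) w (fs i)))
        * I\<Omega> powr (1 - \<zeta> / q)"
    proof (intro mult_right_mono prod_mono conjI)
      fix i assume "i \<in> {..<m}"
      then have i: "i < m" by simp
      have qi: "0 < qs i" using qs i by fastforce
      have m0: "0 \<le> avg p ?B (h i)" unfolding avg_def set_lebesgue_integral_def
        using h0 by (intro divide_nonneg_nonneg integral_nonneg_AE) auto
      have "(\<integral>y. G i y \<partial>haar p) \<le> avg p ?B (h i)"
        using integral_Sg_pdil_le(2)[OF hm[OF i] h0] hB[OF i] i by (simp add: G_def)
      moreover have "0 \<le> (\<integral>y. G i y \<partial>haar p)" by (rule integral_nonneg_AE) (simp add: G0)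
      ultimately have "(\<integral>y. G i y \<partial>haar p) powr a i \<le> avg p ?B (h i) powr (\<zeta> * (1 / qs i))"
        using i z0 qi by (simp add: a_def powr_mono2)
      also have "\<dots> = (avg p ?B (h i) powr \<zeta>) powr (1 / qs i)" by (simp add: powr_powr)
      also have "\<dots> \<le> (K * (?X i / wmeas p w ?B)) powr (1 / qs i)"
        using hB[OF i] qi by (intro powr_mono2) auto
      also have "\<dots> = K powr (1 / qs i) * (?X i / wmeas p w ?B) powr (1 / qs i)"
        by (rule powr_mult)
      also have "\<dots> \<le> K powr (1 / qs i) * (wmeas p w ?B powr lams i * Bnorm p (qs i) (lams i) w (fs i))"
        using fs i qi by (intro mult_left_mono mean_le_Bnorm[OF w]) auto
      finally show "(\<integral>y. G i y \<partial>haar p) powr a i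
          \<le> K powr (1 / qs i) * (wmeas p w ?B powr lams i * Bnorm p (qs i) (lams i) w (fs i))" .
    qed auto
    also have "\<dots> = C * wmeas p w ?B powr (\<Sum>i<m. lams i) * (\<Prod>i<m. Bnorm p (qs i) (lams i) w (fs i))"
      using W by (simp add: C_def prod.distrib powr_sum)
    finally show "(\<integral>y. ?S y * (norm (\<Omega> y) * (\<Prod>i<m. norm (fs i (pdil j y)))) \<partial>haar p)
        \<le> C * wmeas p w ?B powr (\<Sum>i<m. lams i) * (\<Prod>i<m. Bnorm p (qs i) (lams i) w (fs i))" .
  qed
qed

text \<open>In the reverse Hoelder case \<open>Bg p v\<close> is the smaller ball: the inequality is
  applied to it as a subset of \<open>Bg p (v - g)\<close> and so bounds the mass of the larger ball
  from below.\<close>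

lemma wmeas_Bg_dilate_powr_le:
  fixes w :: "('n::finite \<Rightarrow> int \<Rightarrow> nat) \<Rightarrow> real"
  assumes A: "A_weight p \<zeta> w" and z: "1 \<le> \<zeta>" and RH: "RH p r w" and d: "1 < \<delta>" "\<delta> \<le> r" and l: "l < 0"
  obtains C where "0 < C"
    "\<And>v g. 0 \<le> g \<Longrightarrow> wmeas p w (Bg p (v - g)) powr l
       \<le> C * real p powr - (real_of_int g * (real CARD('n) * \<zeta> * l)) * wmeas p w (Bg p v) powr l"
    "\<And>v g. g < 0 \<Longrightarrow> wmeas p w (Bg p (v - g)) powr l
       \<le> C * real p powr - (real_of_int g * (real CARD('n) * l * (\<delta> - 1) / \<delta>)) * wmeas p w (Bg p v) powr l"
proof -
  have w: "is_weight p w" using A by (simp add: A_weight_def)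
  let ?n = "real CARD('n)"
  have ratio: "measure (haar p) (Bg p u :: ('n \<Rightarrow> int \<Rightarrow> nat) set) / measure (haar p) (Bg p v :: ('n \<Rightarrow> int \<Rightarrow> nat) set)
      = real p powr (?n * real_of_int (u - v))" for u v
    by (simp add: measure_Bg right_diff_distrib powr_diff)
  obtain K where K1: "1 \<le> K" and K: "\<And>B E. B \<in> pballs p \<Longrightarrow> E \<in> sets (haar p) \<Longrightarrow> E \<subseteq> B \<Longrightarrow>
       (measure (haar p) E / measure (haar p) B) powr \<zeta> * wmeas p w B \<le> K * wmeas p w E"
    using A_weight_subset[OF A z] by metis
  have r: "1 < r" using d by simp
  obtain L where L0: "0 < L" and L: "\<And>B E. B \<in> pballs p \<Longrightarrow> E \<in> sets (haar p) \<Longrightarrow> E \<subseteq> B \<Longrightarrow>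
       wmeas p w E \<le> L * (measure (haar p) E / measure (haar p) B) powr (1 - 1 / r) * wmeas p w B"
    using RH_subset[OF w RH r] by metis
  define C where "C = max K L powr - l"
  have KL: "0 < max K L" using K1 by simp
  \<comment> \<open>As \<open>t powr l\<close> is decreasing, it turns a lower bound for a mass into
    an upper bound for its power, and the constant crosses over as
    \<open>max K L powr - l\<close>.\<close>
  have flip: "b powr l \<le> C * real p powr (t * l) * a powr l"
    if a: "0 < a" and b: "0 < b" and le: "real p powr t * a \<le> max K L * b" for a b t
  proof -
    have "(max K L * b) powr l \<le> (real p powr t * a) powr l"
      using a le l by (intro powr_mono2') auto
    then have "max K L powr l * b powr l \<le> real p powr (t * l) * a powr l"
      using a b KL by (simp add: powr_mult powr_powr)
    then have "C * (max K L powr l * b powr l) \<le> C * (real p powr (t * l) * a powr l)"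
      by (rule mult_left_mono) (simp add: C_def)
    moreover have "C * max K L powr l = 1" using KL by (simp add: C_def flip: powr_add)
    ultimately show ?thesis
      by (simp add: mult.assoc[symmetric])
  qed
  show ?thesis
  proof (rule that[of C])
    show "0 < C" using KL by (simp add: C_def)
    fix v g :: int assume g: "0 \<le> g"
    have "(real p powr (?n * real_of_int (- g))) powr \<zeta> * wmeas p w (Bg p v) \<le> K * wmeas p w (Bg p (v - g))"
      using K[OF Bg_pballs sets_Bg Bg_mono, of "v - g" v] g ratio[of "v - g" v] by simp
    also have "\<dots> \<le> max K L * wmeas p w (Bg p (v - g))"
      using wmeas_nonneg[OF w] by (intro mult_right_mono) auto
    finally show "wmeas p w (Bg p (v - g)) powr l
       \<le> C * real p powr - (real_of_int g * (?n * \<zeta> * l)) * wmeas p w (Bg p v) powr l"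
      using flip[OF wmeas_Bg_pos[OF w, of v] wmeas_Bg_pos[OF w, of "v - g"], of "- (real_of_int g * ?n * \<zeta>)"]
      by (simp add: powr_powr mult_ac)
  next
    fix v g :: int assume g: "g < 0"
    \<comment> \<open>Since \<open>g < 0\<close>, passing from \<open>r\<close> to the smaller
      \<open>\<delta>\<close> can only increase the power of \<open>p\<close>, so the exponent
      formed with \<open>\<delta>\<close> may be used.\<close>
    have "1 / r \<le> 1 / \<delta>" using d by (intro divide_left_mono) auto
    then have "(?n * real_of_int g) * (1 - 1 / r) \<le> (?n * real_of_int g) * (1 - 1 / \<delta>)"
      using g by (intro mult_left_mono_neg) (auto simp: mult_nonneg_nonpos)
    then have "real p powr ((?n * real_of_int g) * (1 - 1 / r)) \<le> real p powr ((?n * real_of_int g) * (1 - 1 / \<delta>))"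
      by (intro powr_mono) auto
    moreover have "wmeas p w (Bg p v) \<le> L * real p powr ((?n * real_of_int g) * (1 - 1 / r)) * wmeas p w (Bg p (v - g))"
      using L[OF Bg_pballs sets_Bg Bg_mono, of v "v - g"] g ratio[of v "v - g"] by (simp add: powr_powr)
    ultimately have "wmeas p w (Bg p v) \<le> max K L * real p powr ((?n * real_of_int g) * (1 - 1 / \<delta>)) * wmeas p w (Bg p (v - g))"
      using L0 KL wmeas_nonneg[OF w, of "Bg p (v - g)"]
      by (elim order_trans) (auto intro!: mult_right_mono mult_mono)
    then have "real p powr - ((?n * real_of_int g) * (1 - 1 / \<delta>)) * wmeas p w (Bg p v)
        \<le> real p powr - ((?n * real_of_int g) * (1 - 1 / \<delta>)) *
          (max K L * real p powr ((?n * real_of_int g) * (1 - 1 / \<delta>)) * wmeas p w (Bg p (v - g)))"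
      by (rule mult_left_mono) simp
    also have "\<dots> = (real p powr - ((?n * real_of_int g) * (1 - 1 / \<delta>)) * real p powr ((?n * real_of_int g) * (1 - 1 / \<delta>)))
        * (max K L * wmeas p w (Bg p (v - g)))" by (simp only: mult_ac)
    also have "\<dots> = max K L * wmeas p w (Bg p (v - g))" by (simp flip: powr_add)
    finally have "real p powr - ((?n * real_of_int g) * (1 - 1 / \<delta>)) * wmeas p w (Bg p v) \<le> max K L * wmeas p w (Bg p (v - g))" .
    moreover have "- ((?n * real_of_int g) * (1 - 1 / \<delta>)) * l = - (real_of_int g * (?n * l * (\<delta> - 1) / \<delta>))"
      using d by (simp add: field_simps)
    ultimately show "wmeas p w (Bg p (v - g)) powr l
       \<le> C * real p powr - (real_of_int g * (?n * l * (\<delta> - 1) / \<delta>)) * wmeas p w (Bg p v) powr l"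
      using flip[OF wmeas_Bg_pos[OF w, of v] wmeas_Bg_pos[OF w, of "v - g"], of "- ((?n * real_of_int g) * (1 - 1 / \<delta>))"]
      by simp
  qed
qed

text \<open>For \<open>y\<close> in \<open>S\<^sub>0\<close> the point \<open>p^(g - v) y\<close>
  has norm \<open>p^(v - g)\<close>, so the term of index \<open>g\<close> is governed by the mass
  of \<open>Bg p (v - g)\<close>. Comparison with \<open>Bg p v\<close> leaves a factor that depends
  on \<open>g\<close> alone, and these factors are summable.\<close>

lemma Hop_radial_bound:
  fixes m :: nat and qs lams :: "nat \<Rightarrow> real" and \<Omega> :: "('n::finite \<Rightarrow> int \<Rightarrow> nat) \<Rightarrow> complex" and w :: "('n \<Rightarrow> int \<Rightarrow> nat) \<Rightarrow> real"
  assumes A: "A_weight p \<zeta> w" and z: "1 \<le> \<zeta>" and qs: "\<forall>i<m. 1 \<le> qs i"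
    and q: "1 / q = (\<Sum>i<m. 1 / qs i)" and zq: "\<zeta> < q"
    and \<Omega>: "\<Omega> \<in> borel_measurable (haar p)"
    and \<Omega>int: "set_integrable (haar p) (Sg p 0) (\<lambda>y. norm (\<Omega> y) powr ((q / \<zeta>) / (q / \<zeta> - 1)))"
    and RH: "RH p r w" and d: "1 < \<delta>" "\<delta> \<le> r"
    and \<Phi>: "\<forall>x. 0 \<le> \<Phi> x" and lam: "lam = (\<Sum>i<m. lams i)" "lam < 0"
    and sum1: "(\<lambda>g::int. \<Phi> (ppow g) / real p powr (real_of_int g *
            (1 + real CARD('n) * \<zeta> * lam))) summable_on {0..}"
    and sum2: "(\<lambda>g::int. \<Phi> (ppow g) / real p powr (real_of_int g *
            (1 + real CARD('n) * lam * (\<delta> - 1) / \<delta>))) summable_on {..<0}"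
  obtains C where "0 \<le> C"
    "\<And>fs x v. (\<forall>i<m. Bmem p (qs i) (lams i) w (fs i)) \<Longrightarrow> x \<in> Sg p v \<Longrightarrow>
       norm (Hop p \<Phi> \<Omega> m fs x) \<le> C * (\<Prod>i<m. Bnorm p (qs i) (lams i) w (fs i)) * wmeas p w (Bg p v) powr lam"
proof -
  let ?n = "real CARD('n)"
  obtain C1 where C1: "0 \<le> C1" "\<And>fs j. (\<forall>i<m. Bmem p (qs i) (lams i) w (fs i)) \<Longrightarrow>
       (\<integral>y. indicator (Sg p 0) y * (norm (\<Omega> y) * (\<Prod>i<m. norm (fs i (pdil j y)))) \<partial>haar p)
       \<le> C1 * wmeas p w (Bg p (- j)) powr lam * (\<Prod>i<m. Bnorm p (qs i) (lams i) w (fs i))"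
    using norm_sphere_integral_le[OF A z qs q zq \<Omega> \<Omega>int, of lams, folded lam(1)] by blast
  obtain C2 where C2: "0 < C2"
    "\<And>v g. 0 \<le> g \<Longrightarrow> wmeas p w (Bg p (v - g)) powr lam
       \<le> C2 * real p powr - (real_of_int g * (?n * \<zeta> * lam)) * wmeas p w (Bg p v) powr lam"
    "\<And>v g. g < 0 \<Longrightarrow> wmeas p w (Bg p (v - g)) powr lam
       \<le> C2 * real p powr - (real_of_int g * (?n * lam * (\<delta> - 1) / \<delta>)) * wmeas p w (Bg p v) powr lam"
    using wmeas_Bg_dilate_powr_le[OF A z RH d lam(2)] by metis
  \<comment> \<open>The two given series are joined into one over all integers, so that one summable
    majorant serves every \<open>v\<close>.\<close>
  define M where "M g = (if 0 \<le> g
      then \<Phi> (ppow g) / real p powr (real_of_int g * (1 + ?n * \<zeta> * lam))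
      else \<Phi> (ppow g) / real p powr (real_of_int g * (1 + ?n * lam * (\<delta> - 1) / \<delta>)))" for g :: int
  have M0: "0 \<le> M g" for g using \<Phi> by (simp add: M_def)
  have "M summable_on {0..} \<union> {..<0}"
  proof (rule summable_on_Un_disjoint)
    show "M summable_on {0..}" by (rule summable_on_cong[THEN iffD2, OF _ sum1]) (simp add: M_def)
    show "M summable_on {..<0}" by (rule summable_on_cong[THEN iffD2, OF _ sum2]) (simp add: M_def)
  qed auto
  moreover have "{0..} \<union> {..<0} = (UNIV :: int set)" by auto
  ultimately have Msum: "M summable_on UNIV" by simp
  have \<Phi>M: "\<Phi> (ppow g) / real p powr real_of_int g * wmeas p w (Bg p (v - g)) powr lam
      \<le> C2 * M g * wmeas p w (Bg p v) powr lam" for g v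
  proof (cases "0 \<le> g")
    case True
    have "\<Phi> (ppow g) / real p powr real_of_int g * wmeas p w (Bg p (v - g)) powr lam
        \<le> \<Phi> (ppow g) / real p powr real_of_int g *
          (C2 * real p powr - (real_of_int g * (?n * \<zeta> * lam)) * wmeas p w (Bg p v) powr lam)"
      using C2(2)[OF True] \<Phi> by (intro mult_left_mono) auto
    then show ?thesis using True
      by (simp add: M_def distrib_left powr_add powr_minus field_simps)
  next
    case False
    have "\<Phi> (ppow g) / real p powr real_of_int g * wmeas p w (Bg p (v - g)) powr lam
        \<le> \<Phi> (ppow g) / real p powr real_of_int g *
          (C2 * real p powr - (real_of_int g * (?n * lam * (\<delta> - 1) / \<delta>)) * wmeas p w (Bg p v) powr lam)"
      using C2(3)[of g v] False \<Phi> by (intro mult_left_mono) auto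
    also have "\<dots> = C2 * M g * wmeas p w (Bg p v) powr lam"
      using False unfolding M_def distrib_left[of "real_of_int g" 1] powr_add powr_minus by (simp add: divide_inverse mult_ac)
    finally show ?thesis .
  qed
  show ?thesis
  proof (rule that[of "C1 * C2 * (\<Sum>\<^sub>\<infinity>g. M g)"])
    show "0 \<le> C1 * C2 * (\<Sum>\<^sub>\<infinity>g. M g)"
      using C1(1) C2(1) M0 by (intro mult_nonneg_nonneg infsum_nonneg) auto
    fix fs and x :: "'n \<Rightarrow> int \<Rightarrow> nat" and v
    assume fs: "\<forall>i<m. Bmem p (qs i) (lams i) w (fs i)" and x: "x \<in> Sg p v"
    define P where "P = (\<Prod>i<m. Bnorm p (qs i) (lams i) w (fs i))"
    have P0: "0 \<le> P" unfolding P_def using fs by (intro prod_nonneg) (auto intro: Bnorm_nonneg)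
    define T where "T g = (LINT y:Sg p 0|haar p.
         complex_of_real (\<Phi> (ppow g) / real p powr real_of_int g) * \<Omega> y
         * (\<Prod>i<m. fs i (pdil (g - v) y)))" for g
    define R where "R = C1 * P * C2 * wmeas p w (Bg p v) powr lam"
    have T: "norm (T g) \<le> R * M g" for g
    proof -
      let ?c = "\<Phi> (ppow g) / real p powr real_of_int g"
      have c0: "0 \<le> ?c" using \<Phi> by simp
      have "norm (T g) \<le> (\<integral>y. norm (indicator (Sg p 0) y *\<^sub>R (complex_of_real ?c * \<Omega> y
         * (\<Prod>i<m. fs i (pdil (g - v) y)))) \<partial>haar p)"
        unfolding T_def set_lebesgue_integral_def by (rule integral_norm_bound)
      also have "\<dots> = (\<integral>y. ?c * (indicator (Sg p 0) y * (norm (\<Omega> y) * (\<Prod>i<m. norm (fs i (pdil (g - v) y))))) \<partial>haar p)"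
        using \<Phi> by (intro Bochner_Integration.integral_cong)
          (auto simp: norm_mult prod_norm mult_ac simp del: of_real_divide split: split_indicator)
      also have "\<dots> = ?c * (\<integral>y. indicator (Sg p 0) y * (norm (\<Omega> y) * (\<Prod>i<m. norm (fs i (pdil (g - v) y)))) \<partial>haar p)"
        by (rule Bochner_Integration.integral_mult_right_zero)
      also have "\<dots> \<le> ?c * (C1 * wmeas p w (Bg p (v - g)) powr lam * P)"
        using C1(2)[OF fs, of "g - v"] c0 unfolding P_def by (intro mult_left_mono) auto
      also have "\<dots> = C1 * P * (?c * wmeas p w (Bg p (v - g)) powr lam)" by (simp add: mult_ac)
      also have "\<dots> \<le> C1 * P * (C2 * M g * wmeas p w (Bg p v) powr lam)"
        using C1(1) P0 by (intro mult_left_mono \<Phi>M) auto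
      finally show ?thesis by (simp add: R_def mult_ac)
    qed
    have RM: "(\<lambda>g. R * M g) summable_on UNIV" using Msum by (rule summable_on_cmult_right)
    have Tsum: "(\<lambda>g. norm (T g)) summable_on UNIV"
      by (rule summable_on_comparison_test[OF RM]) (use T in auto)
    have "Hop p \<Phi> \<Omega> m fs x = (\<Sum>\<^sub>\<infinity>g. T g)"
      using vexp_Sg[OF x] by (simp add: Hop_def T_def)
    then have "norm (Hop p \<Phi> \<Omega> m fs x) \<le> (\<Sum>\<^sub>\<infinity>g. norm (T g))"
      using norm_infsum_bound[OF Tsum] by simp
    also have "\<dots> \<le> (\<Sum>\<^sub>\<infinity>g. R * M g)" by (rule infsum_mono[OF Tsum RM T])
    also have "\<dots> = R * (\<Sum>\<^sub>\<infinity>g. M g)" by (rule infsum_cmult_right') 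
    finally show "norm (Hop p \<Phi> \<Omega> m fs x) \<le> C1 * C2 * (\<Sum>\<^sub>\<infinity>g. M g)
        * (\<Prod>i<m. Bnorm p (qs i) (lams i) w (fs i)) * wmeas p w (Bg p v) powr lam"
      by (simp add: R_def P_def mult_ac)
  qed
qed

end

theorem theorem3p2:
  fixes p m :: nat
    and qs lams :: "nat \<Rightarrow> real"
    and q qstar \<zeta> \<delta> lamstar :: real
    and \<Omega> :: "('n::finite \<Rightarrow> int \<Rightarrow> nat) \<Rightarrow> complex"
    and \<omega> :: "('n \<Rightarrow> int \<Rightarrow> nat) \<Rightarrow> real"
    and \<Phi> :: "(int \<Rightarrow> nat) \<Rightarrow> real"
  assumes "prime p" and "1 \<le> m"
    and "\<forall>i<m. 1 \<le> qs i"
    and "1 / q = (\<Sum>i<m. 1 / qs i)"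
    and "1 \<le> qstar" and "1 \<le> \<zeta>"
    and "\<forall>x. 0 \<le> \<Phi> x"
    and "(\<lambda>x::unit \<Rightarrow> int \<Rightarrow> nat. \<Phi> (x ())) \<in> borel_measurable (haar p)"
    and "\<Omega> \<in> borel_measurable (haar p)"
    and "AE y in haar p. y \<in> Sg p 0 \<longrightarrow> \<Omega> y \<noteq> 0"
    and "set_integrable (haar p) (Sg p 0)
           (\<lambda>y. norm (\<Omega> y) powr ((q / \<zeta>) / (q / \<zeta> - 1)))"
    and "\<forall>i<m. - 1 / qs i < lams i \<and> lams i < 0"
    and "A_weight p \<zeta> \<omega>"
    and "bdd_above (RH_set p \<omega>)"
    and "q > qstar * \<zeta> * crit_index p \<omega> / (crit_index p \<omega> - 1)"
    and "1 < \<delta>" and "\<delta> < crit_index p \<omega>"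
    and "lamstar = (\<Sum>i<m. lams i)"
    and "(\<lambda>g::int. \<Phi> (ppow g) / real p powr (real_of_int g *
            (1 + real CARD('n) * \<zeta> * lamstar))) summable_on {0..}"
    and "(\<lambda>g::int. \<Phi> (ppow g) / real p powr (real_of_int g *
            (1 + real CARD('n) * lamstar * (\<delta> - 1) / \<delta>))) summable_on {..<0}"
  shows "\<exists>C. \<forall>fs. (\<forall>i<m. Bmem p (qs i) (lams i) \<omega> (fs i)) \<longrightarrow>
            Bmem p qstar lamstar \<omega> (Hop p \<Phi> \<Omega> m fs) \<and>
            Bnorm p qstar lamstar \<omega> (Hop p \<Phi> \<Omega> m fs)
              \<le> C * (\<Prod>i<m. Bnorm p (qs i) (lams i) \<omega> (fs i))"
proof -
  have p: "2 \<le> p" using \<open>prime p\<close> by (rule prime_ge_2_nat)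
  interpret padic p by unfold_locales (rule p)
  have w: "is_weight p \<omega>" using \<open>A_weight p \<zeta> \<omega>\<close> by (simp add: A_weight_def)
  interpret padic_weight p \<omega> by unfold_locales (rule w)
  have "RH_set p \<omega> \<noteq> {}"
    using RH_of_A_weight[OF \<open>A_weight p \<zeta> \<omega>\<close> \<open>1 \<le> \<zeta>\<close>] by (auto simp: RH_set_def)
  \<comment> \<open>The supremum need not itself be a reverse Hoelder exponent;
    \<open>\<delta>\<close> lies strictly below it, which leaves room for one that is.\<close>
  then obtain r where r: "RH p r \<omega>" "\<delta> < r"
    using \<open>\<delta> < crit_index p \<omega>\<close> \<open>bdd_above (RH_set p \<omega>)\<close>
    by (auto simp: crit_index_def less_cSup_iff RH_set_def)
  have c: "1 < crit_index p \<omega>" using \<open>1 < \<delta>\<close> \<open>\<delta> < crit_index p \<omega>\<close> by simp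
  have qz: "qstar * \<zeta> < q"
  proof -
    have "qstar * \<zeta> * 1 \<le> qstar * \<zeta> * (crit_index p \<omega> / (crit_index p \<omega> - 1))"
      using c \<open>1 \<le> qstar\<close> \<open>1 \<le> \<zeta>\<close> by (intro mult_left_mono) auto
    then show ?thesis using \<open>q > qstar * \<zeta> * crit_index p \<omega> / (crit_index p \<omega> - 1)\<close> by simp
  qed
  have "1 * \<zeta> \<le> qstar * \<zeta>" "qstar * 1 \<le> qstar * \<zeta>"
    using \<open>1 \<le> qstar\<close> \<open>1 \<le> \<zeta>\<close> by (intro mult_right_mono mult_left_mono; simp)+
  then have zq: "\<zeta> < q" and qq: "qstar < q" using qz by auto
  have m: "{..<m} \<noteq> {}" using \<open>1 \<le> m\<close> by (auto simp: lessThan_empty_iff)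
  have "lamstar < (\<Sum>i<m. 0)"
    unfolding \<open>lamstar = (\<Sum>i<m. lams i)\<close> using \<open>\<forall>i<m. - 1 / qs i < lams i \<and> lams i < 0\<close> m
    by (intro sum_strict_mono) auto
  then have lam: "lamstar < 0" by simp
  \<comment> \<open>Adding the lower bounds gives \<open>lamstar > - 1 / q\<close>, and
    \<open>qstar < q\<close> then makes \<open>1 + lamstar * qstar\<close> positive.\<close>
  have "(\<Sum>i<m. - (1 / qs i)) < lamstar"
    unfolding \<open>lamstar = (\<Sum>i<m. lams i)\<close> using \<open>\<forall>i<m. - 1 / qs i < lams i \<and> lams i < 0\<close> m
    by (intro sum_strict_mono) auto
  then have "- (1 / q) < lamstar" using \<open>1 / q = (\<Sum>i<m. 1 / qs i)\<close> by (simp add: sum_negf)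
  then have "- (1 / q) * qstar < lamstar * qstar" using \<open>1 \<le> qstar\<close> by (intro mult_strict_right_mono) auto
  moreover have "qstar / q < 1" using qq \<open>1 \<le> qstar\<close> by simp
  ultimately have pos: "0 < 1 + lamstar * qstar" by simp
  obtain C where C: "0 \<le> C"
    "\<And>fs x v. (\<forall>i<m. Bmem p (qs i) (lams i) \<omega> (fs i)) \<Longrightarrow> x \<in> Sg p v \<Longrightarrow>
       norm (Hop p \<Phi> \<Omega> m fs x) \<le> C * (\<Prod>i<m. Bnorm p (qs i) (lams i) \<omega> (fs i)) * wmeas p \<omega> (Bg p v) powr lamstar"
    by (rule Hop_radial_bound[OF assms(13,6,3,4) zq assms(9,11) r(1) assms(16) less_imp_le[OF r(2)] assms(7,18) lam assms(19,20)])
      blast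
  show ?thesis
  proof (intro exI[of _ "C * (1 / (1 + lamstar * qstar)) powr (1 / qstar)"] allI impI)
    fix fs :: "nat \<Rightarrow> ('n \<Rightarrow> int \<Rightarrow> nat) \<Rightarrow> complex"
    assume fs: "\<forall>i<m. Bmem p (qs i) (lams i) \<omega> (fs i)"
    let ?P = "\<Prod>i<m. Bnorm p (qs i) (lams i) \<omega> (fs i)"
    have "0 \<le> ?P" using fs by (intro prod_nonneg) (auto intro: Bnorm_nonneg)
    then have R: "0 \<le> C * ?P" using C(1) by simp
    have s: "0 < qstar" using \<open>1 \<le> qstar\<close> by simp
    show "Bmem p qstar lamstar \<omega> (Hop p \<Phi> \<Omega> m fs) \<and>
        Bnorm p qstar lamstar \<omega> (Hop p \<Phi> \<Omega> m fs)
          \<le> C * (1 / (1 + lamstar * qstar)) powr (1 / qstar) * ?P"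
      using Bnorm_radial_le[OF w s lam pos Hop_measurable R C(2)[OF fs]] by (simp add: mult_ac)
  qed
qed

end
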